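(* Let $r\ge 1$, let $e_1,\dots,e_{r+1}$ be the standard basis of $\mathbb{R}^{r+1}$, and let $m=(m_{i,j})_{1\le i<j\le r+1}$ be positive integers with $M=\sum_{1\le i<j\le r+1}m_{i,j}$. For $a=\sum_{i=1}^r a_i(e_i-e_{r+1})$ with $a_1,\dots,a_r\ge 0$, let $v(a)=v_{A_r^+,m,\mathfrak{c}_{\rm nice}}(a)$ be the volume of the flow polytope $P_{A_r^+,m}(a)$, regarded as a polynomial function of $(a_1,\dots,a_r)$. Writing $\partial_i=\partial/\partial a_i$ for $i=1,\dots,r$, $v$ satisfies the system $$\partial_r^{m_{r,r+1}}v=0,\qquad (\partial_{r-1}-\partial_r)^{m_{r-1,r}}\partial_{r-1}^{m_{r-1,r+1}}v=0,\qquad \dots,$$ $$(\partial_1-\partial_2)^{m_{1,2}}(\partial_1-\partial_3)^{m_{1,3}}\cdots(\partial_1-\partial_r)^{m_{1,r}}\partial_1^{m_{1,r+1}}v=0,$$ i.e. for each $l=1,\dots,r$: $\Big(\prod_{j=l+1}^{r}(\partial_l-\partial_j)^{m_{l,j}}\Big)\partial_l^{m_{l,r+1}}v=0$.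
   Context: Let $V=\{a\in\mathbb{R}^{r+1}:\sum_i a_i=0\}$ and $A_r^+=\{e_i-e_j:1\le i<j\le r+1\}$. The flow polytope is $P_{A_r^+,m}(a)=\{(y_{i,j,k})\in\mathbb{R}^M: 1\le i<j\le r+1,\ 1\le k\le m_{i,j},\ y_{i,j,k}\ge 0,\ \sum_{i<j}\sum_{k=1}^{m_{i,j}}y_{i,j,k}(e_i-e_j)=a\}$. Its volume is measured as follows: the roots generate a lattice in $V$ determining a Lebesgue measure $da$ on $V$; with $du$ the Lebesgue measure on $\mathbb{R}^M$ and $\varphi:\mathbb{R}^M\to V$ the linear map sending the coordinate vector of $y_{i,j,k}$ to $e_i-e_j$, the affine fibre $\varphi^{-1}(a)\supset P_{A_r^+,m}(a)$ carries the quotient measure $du/da$. The nice chamber is $\mathfrak{c}_{\rm nice}=\{\sum_{i=1}^r a_i(e_i-e_{r+1}): a_i>0\}$; on its closure the volume agrees with a homogeneous polynomial of degree $M-r$ in $a_1,\dots,a_r$, denoted $v_{A_r^+,m,\mathfrak{c}_{\rm nice}}(a)$. *)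

theory Defs
  imports "HOL-Analysis.Analysis"
begin

text \<open>
  Vectors of \<open>\<real>\<^sup>r\<^sup>+\<^sup>1\<close> are extensional functions on \<open>{1..r+1}\<close>, vectors of \<open>\<real>\<^sup>M\<close> are extensional
  functions on \<open>flow_index r m\<close>.  A point \<open>(a\<^sub>1, \<dots>, a\<^sub>r)\<close> is any function \<open>a :: nat \<Rightarrow> real\<close>, of which
  only the values on \<open>{1..r}\<close> matter.
\<close>

definition unit_vec :: "nat \<Rightarrow> nat \<Rightarrow> real" where
  "unit_vec i k = (if k = i then 1 else 0)"

definition flow_index :: "nat \<Rightarrow> (nat \<Rightarrow> nat \<Rightarrow> nat) \<Rightarrow> (nat \<times> nat \<times> nat) set" where
  "flow_index r m = {(i, j, k). 1 \<le> i \<and> i < j \<and> j \<le> r + 1 \<and> 1 \<le> k \<and> k \<le> m i j}"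

definition flow_dim :: "nat \<Rightarrow> (nat \<Rightarrow> nat \<Rightarrow> nat) \<Rightarrow> nat" where
  "flow_dim r m = (\<Sum>i = 1..r. \<Sum>j = i + 1..r + 1. m i j)"

definition flow_space :: "nat \<Rightarrow> (nat \<Rightarrow> nat \<Rightarrow> nat) \<Rightarrow> (nat \<times> nat \<times> nat \<Rightarrow> real) measure" where
  "flow_space r m = Pi\<^sub>M (flow_index r m) (\<lambda>_. lborel)"

definition root_space :: "nat \<Rightarrow> (nat \<Rightarrow> real) set" where
  "root_space r = {a \<in> {1..r + 1} \<rightarrow>\<^sub>E UNIV. (\<Sum>i = 1..r + 1. a i) = 0}"

definition chamber_vec :: "nat \<Rightarrow> (nat \<Rightarrow> real) \<Rightarrow> nat \<Rightarrow> real" where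
  "chamber_vec r a =
     (\<lambda>k\<in>{1..r + 1}. \<Sum>i = 1..r. a i * (unit_vec i k - unit_vec (r + 1) k))"

text \<open>
  The measure \<open>da\<close>: the vectors \<open>e\<^sub>i - e\<^sub>r\<^sub>+\<^sub>1\<close>, \<open>1 \<le> i \<le> r\<close>, form a \<open>\<int>\<close>-basis of the lattice generated
  by the roots, so the measure giving this lattice covolume 1 is Lebesgue measure in the
  coordinates with respect to that basis.
\<close>

definition root_measure :: "nat \<Rightarrow> (nat \<Rightarrow> real) measure" where
  "root_measure r =
     distr (Pi\<^sub>M {1..r} (\<lambda>_. lborel))
       (restrict_space (Pi\<^sub>M {1..r + 1} (\<lambda>_. borel)) (root_space r)) (chamber_vec r)"

definition flow_map ::
  "nat \<Rightarrow> (nat \<Rightarrow> nat \<Rightarrow> nat) \<Rightarrow> (nat \<times> nat \<times> nat \<Rightarrow> real) \<Rightarrow> nat \<Rightarrow> real" where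
  "flow_map r m y =
     (\<lambda>v\<in>{1..r + 1}. \<Sum>(i, j, k)\<in>flow_index r m. y (i, j, k) * (unit_vec i v - unit_vec j v))"

definition flow_fibre ::
  "nat \<Rightarrow> (nat \<Rightarrow> nat \<Rightarrow> nat) \<Rightarrow> (nat \<Rightarrow> real) \<Rightarrow> (nat \<times> nat \<times> nat \<Rightarrow> real) set" where
  "flow_fibre r m a = {y \<in> flow_index r m \<rightarrow>\<^sub>E UNIV. flow_map r m y = a}"

definition flow_polytope ::
  "nat \<Rightarrow> (nat \<Rightarrow> nat \<Rightarrow> nat) \<Rightarrow> (nat \<Rightarrow> real) \<Rightarrow> (nat \<times> nat \<times> nat \<Rightarrow> real) set" where
  "flow_polytope r m a = {y \<in> flow_fibre r m a. \<forall>e\<in>flow_index r m. 0 \<le> y e}"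

text \<open>
  \<open>\<mu> a\<close> is the quotient measure \<open>du/da\<close> on the fibre over \<open>a\<close>: each \<open>\<mu> a\<close> is the translate of the
  measure on the kernel by any point of the fibre (so \<open>\<mu>\<close> on the kernel is translation invariant),
  and integrating the fibre measures against \<open>da\<close> gives back \<open>du\<close>.  The last condition alone would
  determine \<open>\<mu> a\<close> only for almost all \<open>a\<close>; together they determine it for every \<open>a\<close> in
  \<open>root_space r\<close>.
\<close>

definition is_quotient_measure ::
  "nat \<Rightarrow> (nat \<Rightarrow> nat \<Rightarrow> nat) \<Rightarrow> ((nat \<Rightarrow> real) \<Rightarrow> (nat \<times> nat \<times> nat \<Rightarrow> real) measure) \<Rightarrow> bool" where
  "is_quotient_measure r m \<mu> \<longleftrightarrow>
     (\<forall>a\<in>root_space r.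
        sets (\<mu> a) = sets (restrict_space (flow_space r m) (flow_fibre r m a))) \<and>
     (\<forall>a\<in>root_space r. \<forall>u\<in>flow_fibre r m a.
        \<mu> a = distr (\<mu> (\<lambda>k\<in>{1..r + 1}. 0))
                (restrict_space (flow_space r m) (flow_fibre r m a))
                (\<lambda>n. \<lambda>e\<in>flow_index r m. u e + n e)) \<and>
     (\<forall>A\<in>sets (flow_space r m).
        emeasure (flow_space r m) A =
          (\<integral>\<^sup>+ a. emeasure (\<mu> a) (A \<inter> flow_fibre r m a) \<partial>root_measure r))"

definition quotient_measure ::
  "nat \<Rightarrow> (nat \<Rightarrow> nat \<Rightarrow> nat) \<Rightarrow> (nat \<Rightarrow> real) \<Rightarrow> (nat \<times> nat \<times> nat \<Rightarrow> real) measure" where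
  "quotient_measure r m = (SOME \<mu>. is_quotient_measure r m \<mu>)"

definition flow_volume :: "nat \<Rightarrow> (nat \<Rightarrow> nat \<Rightarrow> nat) \<Rightarrow> (nat \<Rightarrow> real) \<Rightarrow> real" where
  "flow_volume r m a = measure (quotient_measure r m a) (flow_polytope r m a)"

definition homogeneous_polynomial :: "nat \<Rightarrow> nat \<Rightarrow> ((nat \<Rightarrow> real) \<Rightarrow> real) \<Rightarrow> bool" where
  "homogeneous_polynomial r d f \<longleftrightarrow>
     (\<exists>(S :: (nat \<Rightarrow> nat) set) c. finite S \<and> (\<forall>\<alpha>\<in>S. (\<Sum>i = 1..r. \<alpha> i) = d) \<and>
        (\<forall>a. f a = (\<Sum>\<alpha>\<in>S. c \<alpha> * (\<Prod>i = 1..r. a i ^ \<alpha> i))))"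

text \<open>
  The polynomial is evaluated at all \<open>a\<close>, but is compared with the volume only on the closure of
  the nice chamber, which has nonempty interior and hence determines it.
\<close>

definition nice_volume :: "nat \<Rightarrow> (nat \<Rightarrow> nat \<Rightarrow> nat) \<Rightarrow> (nat \<Rightarrow> real) \<Rightarrow> real" where
  "nice_volume r m =
     (THE v. homogeneous_polynomial r (flow_dim r m - r) v \<and>
        (\<forall>a. (\<forall>i\<in>{1..r}. 0 \<le> a i) \<longrightarrow> v a = flow_volume r m (chamber_vec r a)))"

definition pderiv_at :: "nat \<Rightarrow> ((nat \<Rightarrow> real) \<Rightarrow> real) \<Rightarrow> (nat \<Rightarrow> real) \<Rightarrow> real" where
  "pderiv_at i f = (\<lambda>a. deriv (\<lambda>t. f (a(i := t))) (a i))"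

definition pderiv_diff :: "nat \<Rightarrow> nat \<Rightarrow> ((nat \<Rightarrow> real) \<Rightarrow> real) \<Rightarrow> (nat \<Rightarrow> real) \<Rightarrow> real" where
  "pderiv_diff i j f = (\<lambda>a. pderiv_at i f a - pderiv_at j f a)"

text \<open>
  The composite \<open>(\<partial>\<^sub>l - \<partial>\<^sub>l\<^sub>+\<^sub>1)\<^bsup>m l (l+1)\<^esup> \<circ> \<dots> \<circ> (\<partial>\<^sub>l - \<partial>\<^sub>r)\<^bsup>m l r\<^esup> \<circ> \<partial>\<^sub>l\<^bsup>m l (r+1)\<^esup>\<close>; the index list is
  \<open>l+1, \<dots>, r\<close>, so it is empty for \<open>l = r\<close>.
\<close>

definition flow_operator ::
  "nat \<Rightarrow> (nat \<Rightarrow> nat \<Rightarrow> nat) \<Rightarrow> nat \<Rightarrow> ((nat \<Rightarrow> real) \<Rightarrow> real) \<Rightarrow> (nat \<Rightarrow> real) \<Rightarrow> real" where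
  "flow_operator r m l =
     foldr (\<lambda>j D. (pderiv_diff l j ^^ m l j) \<circ> D) [l + 1..<r + 1] (pderiv_at l ^^ m l (r + 1))"

end

theory Submission
  imports Defs "HOL-Computational_Algebra.Polynomial"
begin

text \<open>
  The fibre over \<open>a\<close> is parametrized by the coordinates off the edges \<open>(i, r + 1, 1)\<close>; in this chart the
  quotient measure is Lebesgue measure, and the polytope is the region where the remaining \<open>r\<close>
  coordinates \<open>a\<^sub>i - (outflow) + (inflow)\<close> are nonnegative too.  Starting from these \<open>r\<close> edges, where the
  volume on the nice chamber is 1, the other edges are added one at a time, in order of
  descending source.  Adding an edge from \<open>l\<close> to \<open>j\<close> replaces the volume \<open>v\<close> by
  \<open>\<integral>\<^sub>0\<^bsup>a\<^sub>l\<^esup> v(a - t (e\<^sub>l - e\<^sub>j)) dt\<close>, because no flow enters \<open>l\<close> yet; this is the polynomial antiderivative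
  of \<open>v\<close> for \<open>\<partial>\<^sub>l - \<partial>\<^sub>j\<close> that vanishes on \<open>a\<^sub>l = 0\<close>.  The operator of index \<open>l\<close> thus undoes all edges
  with source \<open>l\<close> and applies one more \<open>\<partial>\<^sub>l\<close> to a polynomial that does not involve \<open>a\<^sub>l\<close>.  Edges added
  later have smaller sources, and any equation without \<open>\<partial>\<^sub>l\<close> survives the addition of edges with source \<open>l\<close>.
\<close>

section \<open>Polynomial functions and their antiderivatives\<close>

text \<open>Membership is inductive, so facts about derivatives need only the sum and product rules.
  The variables are confined to \<open>{1..r}\<close>, which makes derivatives in other indices, in
  particular in \<open>r + 1\<close>, vanish.\<close>

inductive polyfun :: "nat \<Rightarrow> ((nat \<Rightarrow> real) \<Rightarrow> real) \<Rightarrow> bool" for r where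
  const: "polyfun r (\<lambda>_. c)"
| var: "i \<in> {1..r} \<Longrightarrow> polyfun r (\<lambda>a. a i)"
| add: "polyfun r f \<Longrightarrow> polyfun r g \<Longrightarrow> polyfun r (\<lambda>a. f a + g a)"
| mult: "polyfun r f \<Longrightarrow> polyfun r g \<Longrightarrow> polyfun r (\<lambda>a. f a * g a)"

lemma polyfun_diff: "polyfun r f \<Longrightarrow> polyfun r g \<Longrightarrow> polyfun r (\<lambda>a. f a - g a)"
  using polyfun.add[OF _ polyfun.mult[OF polyfun.const[of r "-1"]], of f g] by simp

lemma polyfun_sum: "(\<And>x. x \<in> A \<Longrightarrow> polyfun r (f x)) \<Longrightarrow> polyfun r (\<lambda>a. \<Sum>x\<in>A. f x a)"
  by (induction A rule: infinite_finite_induct) (auto intro: polyfun.intros)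

lemma polyfun_prod: "(\<And>x. x \<in> A \<Longrightarrow> polyfun r (f x)) \<Longrightarrow> polyfun r (\<lambda>a. \<Prod>x\<in>A. f x a)"
  by (induction A rule: infinite_finite_induct) (auto intro: polyfun.intros)

lemma polyfun_power: "polyfun r f \<Longrightarrow> polyfun r (\<lambda>a. f a ^ n)"
  by (induction n) (auto intro: polyfun.intros)

lemma polyfun_homogeneous: "homogeneous_polynomial r d f \<Longrightarrow> polyfun r f"
proof -
  assume "homogeneous_polynomial r d f"
  then obtain S c where "f = (\<lambda>a. \<Sum>\<alpha>\<in>(S :: (nat \<Rightarrow> nat) set). c \<alpha> * (\<Prod>i = 1..r. a i ^ \<alpha> i))"
    unfolding homogeneous_polynomial_def by blast
  then show ?thesis
    by (auto intro!: polyfun_sum polyfun.mult polyfun.const polyfun_prod polyfun_power polyfun.var)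
qed

lemma polyfun_differentiable:
  assumes "polyfun r f"
  shows "(\<lambda>t. f (a(i := t))) differentiable at x"
  using assms
proof induction
  case (var k)
  show ?case by (cases "k = i") auto
qed auto

lemma polyfun_has_pderiv:
  assumes "polyfun r f"
  shows "((\<lambda>t. f (a(i := t))) has_real_derivative pderiv_at i f a) (at (a i))"
  using polyfun_differentiable[OF assms, of a i "a i"]
  unfolding pderiv_at_def real_differentiable_def by (metis DERIV_imp_deriv)

section \<open>Calculus of partial derivatives on polynomial functions\<close>

lemma pderiv_at_const [simp]: "pderiv_at i (\<lambda>_. c) = (\<lambda>_. 0)"
  by (simp add: pderiv_at_def)

lemma pderiv_at_var: "pderiv_at i (\<lambda>a. a k) = (\<lambda>_. unit_vec i k)"
  by (auto simp: pderiv_at_def unit_vec_def)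

lemma pderiv_at_add:
  assumes "polyfun r f" "polyfun r g"
  shows "pderiv_at i (\<lambda>a. f a + g a) = (\<lambda>a. pderiv_at i f a + pderiv_at i g a)"
proof
  fix a
  show "pderiv_at i (\<lambda>a. f a + g a) a = pderiv_at i f a + pderiv_at i g a"
    unfolding pderiv_at_def[of i "\<lambda>a. f a + g a"]
    by (intro DERIV_imp_deriv DERIV_add polyfun_has_pderiv[OF assms(1)] polyfun_has_pderiv[OF assms(2)])
qed

lemma pderiv_at_mult:
  assumes "polyfun r f" "polyfun r g"
  shows "pderiv_at i (\<lambda>a. f a * g a) = (\<lambda>a. pderiv_at i f a * g a + f a * pderiv_at i g a)"
proof
  fix a
  show "pderiv_at i (\<lambda>a. f a * g a) a = pderiv_at i f a * g a + f a * pderiv_at i g a"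
    unfolding pderiv_at_def[of i "\<lambda>a. f a * g a"]
    using DERIV_mult[OF polyfun_has_pderiv[OF assms(1), of a i] polyfun_has_pderiv[OF assms(2), of a i]]
    by (intro DERIV_imp_deriv) (simp add: algebra_simps)
qed

lemma pderiv_at_diff:
  assumes "polyfun r f" "polyfun r g"
  shows "pderiv_at i (\<lambda>a. f a - g a) = (\<lambda>a. pderiv_at i f a - pderiv_at i g a)"
proof
  fix a
  show "pderiv_at i (\<lambda>a. f a - g a) a = pderiv_at i f a - pderiv_at i g a"
    unfolding pderiv_at_def[of i "\<lambda>a. f a - g a"]
    by (intro DERIV_imp_deriv DERIV_diff polyfun_has_pderiv[OF assms(1)] polyfun_has_pderiv[OF assms(2)])
qed

lemma polyfun_pderiv_at: "polyfun r f \<Longrightarrow> polyfun r (pderiv_at i f)"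
  by (induction rule: polyfun.induct)
    (auto simp: pderiv_at_var pderiv_at_add pderiv_at_mult intro!: polyfun.intros)

lemma polyfun_pderiv_diff: "polyfun r f \<Longrightarrow> polyfun r (pderiv_diff i j f)"
  unfolding pderiv_diff_def by (intro polyfun_diff polyfun_pderiv_at)

lemma pderiv_at_commute:
  assumes "polyfun r f"
  shows "pderiv_at i (pderiv_at k f) = pderiv_at k (pderiv_at i f)"
  using assms
proof induction
  case (mult f g)
  \<comment> \<open>The product rule is applied twice, for arbitrary \<open>i\<close> and
    \<open>k\<close>. Once the induction hypotheses identify the mixed derivatives of the factors,
    the result is symmetric in the two indices.\<close>
  have "pderiv_at i (pderiv_at k (\<lambda>a. f a * g a)) =
    (\<lambda>a. (pderiv_at i (pderiv_at k f) a * g a + pderiv_at k f a * pderiv_at i g a) +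
      (pderiv_at i f a * pderiv_at k g a + f a * pderiv_at i (pderiv_at k g) a))" for i k
    using mult(1,2)
    by (simp add: pderiv_at_mult[of r] pderiv_at_add[of r] polyfun.mult polyfun_pderiv_at)
  then show ?case by (simp add: mult.IH algebra_simps)
qed (simp_all add: pderiv_at_var pderiv_at_add[of r] polyfun_pderiv_at)

lemma pderiv_at_pderiv_diff:
  assumes "polyfun r f"
  shows "pderiv_at k (pderiv_diff i j f) = pderiv_diff i j (pderiv_at k f)"
  using assms
  by (simp add: pderiv_diff_def pderiv_at_diff[OF polyfun_pderiv_at polyfun_pderiv_at]
      pderiv_at_commute[of r f k])

lemma pderiv_diff_commute:
  assumes "polyfun r f"
  shows "pderiv_diff k n (pderiv_diff i j f) = pderiv_diff i j (pderiv_diff k n f)"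
  using pderiv_at_pderiv_diff[OF assms, of k i j] pderiv_at_pderiv_diff[OF assms, of n i j]
  by (simp add: pderiv_diff_def pderiv_at_diff[of r] polyfun_pderiv_at assms algebra_simps)

lemma pderiv_at_outside:
  assumes "polyfun r f" "i \<notin> {1..r}"
  shows "pderiv_at i f = (\<lambda>_. 0)"
  using assms
  by induction (auto simp: pderiv_at_var pderiv_at_add pderiv_at_mult unit_vec_def)

text \<open>The vertex \<open>r + 1\<close> has no coordinate of its own, so the operator of an edge
  into it reduces to \<open>pderiv_at l\<close>. Edges into the sink can thus be treated like all
  others.\<close>

lemma pderiv_diff_outside: "polyfun r f \<Longrightarrow> pderiv_diff l (r + 1) f = pderiv_at l f"
  using pderiv_at_outside[of r f "r + 1"] by (simp add: pderiv_diff_def)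

lemma pderiv_diff_add:
  assumes "polyfun r f" "polyfun r g"
  shows "pderiv_diff i j (\<lambda>a. f a + g a) = (\<lambda>a. pderiv_diff i j f a + pderiv_diff i j g a)"
  using assms by (simp add: pderiv_diff_def pderiv_at_add algebra_simps)

lemma pderiv_diff_mult:
  assumes "polyfun r f" "polyfun r g"
  shows "pderiv_diff i j (\<lambda>a. f a * g a) = (\<lambda>a. pderiv_diff i j f a * g a + f a * pderiv_diff i j g a)"
  using assms by (simp add: pderiv_diff_def pderiv_at_mult algebra_simps)

lemma pderiv_diff_var: "pderiv_diff i j (\<lambda>a. a k) = (\<lambda>_. unit_vec i k - unit_vec j k)"
  by (simp add: pderiv_diff_def pderiv_at_var)

lemma pderiv_diff_const [simp]: "pderiv_diff i j (\<lambda>_. c) = (\<lambda>_. 0)"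
  by (simp add: pderiv_diff_def)

lemma pderiv_diff_power:
  assumes "polyfun r f"
  shows "pderiv_diff i j (\<lambda>a. f a ^ Suc n) = (\<lambda>a. real (Suc n) * f a ^ n * pderiv_diff i j f a)"
proof (induction n)
  case (Suc n)
  have "pderiv_diff i j (\<lambda>a. f a ^ Suc (Suc n)) = pderiv_diff i j (\<lambda>a. f a * f a ^ Suc n)" by simp
  also have "\<dots> = (\<lambda>a. real (Suc (Suc n)) * f a ^ Suc n * pderiv_diff i j f a)"
    by (subst pderiv_diff_mult[OF assms polyfun_power[OF assms]], subst Suc)
      (simp add: algebra_simps)
  finally show ?case .
qed simp

section \<open>Polynomial functions along lines\<close>

definition shift :: "nat \<Rightarrow> nat \<Rightarrow> (nat \<Rightarrow> real) \<Rightarrow> real \<Rightarrow> nat \<Rightarrow> real" where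
  "shift i j a t = (\<lambda>k. a k + t * (unit_vec i k - unit_vec j k))"

text \<open>The chain rule along a line; induction over \<open>polyfun\<close> avoids any appeal to
  total differentiability in several variables.\<close>

lemma polyfun_has_derivative_along:
  assumes "polyfun r f"
  shows "((\<lambda>t. f (shift i j a t)) has_real_derivative pderiv_diff i j f (shift i j a t)) (at t)"
  using assms
proof induction
  case (var k)
  show ?case by (auto simp: pderiv_diff_var shift_def intro!: derivative_eq_intros)
next
  case (add f g)
  then show ?case by (simp add: pderiv_diff_add DERIV_add)
next
  case (mult f g)
  then show ?case
    using DERIV_mult[OF mult.IH] by (simp add: pderiv_diff_mult algebra_simps)
qed simp

lemma shift_to_zero: "l \<noteq> j \<Longrightarrow> shift l j a (- a l) l = 0"
  by (simp add: shift_def unit_vec_def)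

text \<open>A function killed by the operator is constant on each line in direction
  \<open>e_l - e_j\<close>, and as \<open>l\<close> differs from \<open>j\<close> every such line
  meets the hyperplane \<open>a l = 0\<close>.\<close>

lemma pderiv_diff_unique:
  assumes "polyfun r f" "l \<noteq> j" "pderiv_diff l j f = (\<lambda>_. 0)" "\<And>a. a l = 0 \<Longrightarrow> f a = 0"
  shows "f = (\<lambda>_. 0)"
proof
  fix a
  have "f (shift l j a 0) = f (shift l j a (- a l))"
    using polyfun_has_derivative_along[OF assms(1), of l j a] assms(3)
    by (intro DERIV_isconst_all) auto
  then show "f a = 0"
    using assms(2,4) shift_to_zero[of l j a] by (simp add: shift_def)
qed

text \<open>On the line from the all-ones point to \<open>a\<close>, \<open>f\<close> is a
  polynomial in one parameter \<open>t\<close>. The points with small \<open>t\<close> lie in the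
  orthant, so it has infinitely many roots and vanishes at \<open>t = 1\<close>, which is the point
  \<open>a\<close>.\<close>

lemma polyfun_eq_zero_if_zero_on_orthant:
  assumes f: "polyfun r f" and zero: "\<And>a. (\<forall>i\<in>{1..r}. 0 \<le> a i) \<Longrightarrow> f a = 0"
  shows "f a = 0"
proof -
  have "\<exists>p. \<forall>t. f (\<lambda>i. 1 + t * (a i - 1)) = poly p t"
    using f
  proof induction
    case (const c)
    show ?case by (rule exI[of _ "[:c:]"]) simp
  next
    case (var i)
    show ?case by (rule exI[of _ "[:1, a i - 1:]"]) simp
  next
    case (add f g)
    then show ?case by (metis poly_add)
  next
    case (mult f g)
    then show ?case by (metis poly_mult)
  qed
  then obtain p where p: "\<And>t. f (\<lambda>i. 1 + t * (a i - 1)) = poly p t" by blast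
  \<comment> \<open>For \<open>t\<close> up to \<open>1 / K\<close> no coordinate moves by more than
    1 from its starting value 1. The summand 1 keeps \<open>K\<close> positive.\<close>
  define K where "K = 1 + (\<Sum>i\<in>{1..r}. \<bar>a i - 1\<bar>)"
  have K: "0 < K" "\<And>i. i \<in> {1..r} \<Longrightarrow> \<bar>a i - 1\<bar> \<le> K"
  proof -
    show "0 < K" unfolding K_def by (simp add: add_pos_nonneg sum_nonneg)
    fix i assume "i \<in> {1..r}"
    then have "\<bar>a i - 1\<bar> \<le> (\<Sum>i\<in>{1..r}. \<bar>a i - 1\<bar>)" by (intro member_le_sum) auto
    then show "\<bar>a i - 1\<bar> \<le> K" by (simp add: K_def)
  qed
  have "poly p t = 0" if "t \<in> {0..1 / K}" for t
    unfolding p[symmetric]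
  proof (rule zero, intro ballI)
    fix i assume i: "i \<in> {1..r}"
    have "\<bar>t * (a i - 1)\<bar> \<le> 1 / K * K"
      unfolding abs_mult using that K(1) K(2)[OF i] by (intro mult_mono) auto
    then show "0 \<le> 1 + t * (a i - 1)" using K(1) by simp
  qed
  then have "{0..1 / K} \<subseteq> {t. poly p t = 0}" by auto
  moreover have "infinite {0..1 / K}" using K(1) by (simp add: infinite_Icc)
  ultimately have "p = 0" using poly_roots_finite finite_subset by blast
  then show ?thesis using p[of 1] by simp
qed

section \<open>Closure properties of homogeneous polynomials, and antiderivatives\<close>

lemma homogeneous_zero: "homogeneous_polynomial r d (\<lambda>_. 0)"
  unfolding homogeneous_polynomial_def by (rule exI[of _ "{}"]) auto

lemma homogeneous_monomial:
  "(\<Sum>i = 1..r. \<alpha> i) = d \<Longrightarrow> homogeneous_polynomial r d (\<lambda>a. c * (\<Prod>i = 1..r. a i ^ \<alpha> i))"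
  unfolding homogeneous_polynomial_def by (rule exI[of _ "{\<alpha>}"], rule exI[of _ "\<lambda>_. c"]) auto

lemma homogeneous_add:
  assumes "homogeneous_polynomial r d f" "homogeneous_polynomial r d g"
  shows "homogeneous_polynomial r d (\<lambda>a. f a + g a)"
proof -
  obtain S :: "(nat \<Rightarrow> nat) set" and b where
    S: "finite S" "\<forall>\<alpha>\<in>S. (\<Sum>i = 1..r. \<alpha> i) = d" "\<And>a. f a = (\<Sum>\<alpha>\<in>S. b \<alpha> * (\<Prod>i = 1..r. a i ^ \<alpha> i))"
    using assms(1) unfolding homogeneous_polynomial_def by blast
  obtain T :: "(nat \<Rightarrow> nat) set" and c where
    T: "finite T" "\<forall>\<alpha>\<in>T. (\<Sum>i = 1..r. \<alpha> i) = d" "\<And>a. g a = (\<Sum>\<alpha>\<in>T. c \<alpha> * (\<Prod>i = 1..r. a i ^ \<alpha> i))"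
    using assms(2) unfolding homogeneous_polynomial_def by blast
  \<comment> \<open>Coefficients are extended by zero, so that both sums run over the same exponent
    set.\<close>
  let ?b = "\<lambda>\<alpha>. if \<alpha> \<in> S then b \<alpha> else 0" and ?c = "\<lambda>\<alpha>. if \<alpha> \<in> T then c \<alpha> else 0"
  have "f a + g a = (\<Sum>\<alpha>\<in>S \<union> T. (?b \<alpha> + ?c \<alpha>) * (\<Prod>i = 1..r. a i ^ \<alpha> i))" for a
  proof -
    have "f a = (\<Sum>\<alpha>\<in>S \<union> T. ?b \<alpha> * (\<Prod>i = 1..r. a i ^ \<alpha> i))"
      unfolding S(3) using S(1) T(1) by (intro sum.mono_neutral_cong_left) auto
    moreover have "g a = (\<Sum>\<alpha>\<in>S \<union> T. ?c \<alpha> * (\<Prod>i = 1..r. a i ^ \<alpha> i))"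
      unfolding T(3) using S(1) T(1) by (intro sum.mono_neutral_cong_left) auto
    ultimately show ?thesis by (simp add: ring_distribs sum.distrib)
  qed
  then show ?thesis
    unfolding homogeneous_polynomial_def using S(1,2) T(1,2)
    by (intro exI[of _ "S \<union> T"] exI[of _ "\<lambda>\<alpha>. ?b \<alpha> + ?c \<alpha>"]) auto
qed

lemma homogeneous_sum:
  "(\<And>x. x \<in> A \<Longrightarrow> homogeneous_polynomial r d (f x)) \<Longrightarrow>
    homogeneous_polynomial r d (\<lambda>a. \<Sum>x\<in>A. f x a)"
  by (induction A rule: infinite_finite_induct) (auto intro: homogeneous_zero homogeneous_add)

lemma homogeneous_mult:
  assumes "homogeneous_polynomial r d f" "homogeneous_polynomial r e g"
  shows "homogeneous_polynomial r (d + e) (\<lambda>a. f a * g a)"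
proof -
  obtain S :: "(nat \<Rightarrow> nat) set" and b where
    S: "\<forall>\<alpha>\<in>S. (\<Sum>i = 1..r. \<alpha> i) = d" "\<And>a. f a = (\<Sum>\<alpha>\<in>S. b \<alpha> * (\<Prod>i = 1..r. a i ^ \<alpha> i))"
    using assms(1) unfolding homogeneous_polynomial_def by blast
  obtain T :: "(nat \<Rightarrow> nat) set" and c where
    T: "\<forall>\<alpha>\<in>T. (\<Sum>i = 1..r. \<alpha> i) = e" "\<And>a. g a = (\<Sum>\<alpha>\<in>T. c \<alpha> * (\<Prod>i = 1..r. a i ^ \<alpha> i))"
    using assms(2) unfolding homogeneous_polynomial_def by blast
  \<comment> \<open>Different pairs of exponents can give the same monomial. Treating the double sum
    as a sum of homogeneous polynomials leaves the collecting of like terms to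
    \<open>homogeneous_add\<close>.\<close>
  have "(\<lambda>a. f a * g a) =
    (\<lambda>a. \<Sum>\<alpha>\<in>S. \<Sum>\<beta>\<in>T. (b \<alpha> * c \<beta>) * (\<Prod>i = 1..r. a i ^ (\<alpha> i + \<beta> i)))"
    unfolding S(2) T(2) sum_product
    by (simp add: power_add prod.distrib mult_ac)
  then show ?thesis
    using S(1) T(1)
    by (simp only:) (intro homogeneous_sum homogeneous_monomial, simp add: sum.distrib)
qed

lemma homogeneous_const: "homogeneous_polynomial r 0 (\<lambda>_. c)"
  using homogeneous_monomial[of "\<lambda>_. 0" r 0 c] by simp

lemma homogeneous_var:
  assumes "i \<in> {1..r}"
  shows "homogeneous_polynomial r 1 (\<lambda>a. a i)"
proof -
  have "(\<lambda>a. a i) = (\<lambda>a. 1 * (\<Prod>k = 1..r. (a k :: real) ^ (if k = i then 1 else 0)))"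
    using assms by (simp add: if_distrib[of "\<lambda>n. _ ^ n"] cong: if_cong)
  then show ?thesis
    using homogeneous_monomial[of "\<lambda>k. if k = i then 1 else 0" r 1 1] assms by simp
qed

lemma homogeneous_power: "homogeneous_polynomial r d f \<Longrightarrow> homogeneous_polynomial r (n * d) (\<lambda>a. f a ^ n)"
  by (induction n) (auto intro: homogeneous_const homogeneous_mult)

text \<open>The boundary condition on \<open>a l = 0\<close> fixes the constant of integration on
  each line, so for \<open>l\<close> different from \<open>j\<close> there is at most one such
  \<open>g\<close>, by \<open>pderiv_diff_unique\<close>.\<close>

definition antiderivative :: "nat \<Rightarrow> nat \<Rightarrow> nat \<Rightarrow> nat \<Rightarrow> ((nat \<Rightarrow> real) \<Rightarrow> real) \<Rightarrow> bool" where
  "antiderivative r l j d f \<longleftrightarrow> (\<exists>g. homogeneous_polynomial r (d + 1) g \<and> pderiv_diff l j g = f \<and>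
     (\<forall>a. a l = 0 \<longrightarrow> g a = 0))"

lemma antiderivative_zero: "antiderivative r l j d (\<lambda>_. 0)"
  unfolding antiderivative_def by (rule exI[of _ "\<lambda>_. 0"]) (simp add: homogeneous_zero)

lemma antiderivative_add:
  assumes "antiderivative r l j d f" "antiderivative r l j d g"
  shows "antiderivative r l j d (\<lambda>a. f a + g a)"
proof -
  obtain u where u: "homogeneous_polynomial r (d + 1) u" "pderiv_diff l j u = f" "\<forall>a. a l = 0 \<longrightarrow> u a = 0"
    using assms(1) unfolding antiderivative_def by blast
  obtain v where v: "homogeneous_polynomial r (d + 1) v" "pderiv_diff l j v = g" "\<forall>a. a l = 0 \<longrightarrow> v a = 0"
    using assms(2) unfolding antiderivative_def by blast
  show ?thesis
    unfolding antiderivative_def using u v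
    by (intro exI[of _ "\<lambda>a. u a + v a"])
      (simp add: homogeneous_add pderiv_diff_add[OF polyfun_homogeneous polyfun_homogeneous])
qed

lemma antiderivative_cmult:
  assumes "antiderivative r l j d f"
  shows "antiderivative r l j d (\<lambda>a. c * f a)"
proof -
  obtain u where u: "homogeneous_polynomial r (d + 1) u" "pderiv_diff l j u = f" "\<forall>a. a l = 0 \<longrightarrow> u a = 0"
    using assms(1) unfolding antiderivative_def by blast
  show ?thesis
    unfolding antiderivative_def using u homogeneous_mult[OF homogeneous_const[of r c] u(1)]
    by (intro exI[of _ "\<lambda>a. c * u a"])
      (simp add: pderiv_diff_mult[OF polyfun.const polyfun_homogeneous])
qed

lemma antiderivative_sum:
  "(\<And>x. x \<in> A \<Longrightarrow> antiderivative r l j d (f x)) \<Longrightarrow> antiderivative r l j d (\<lambda>a. \<Sum>x\<in>A. f x a)"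
  by (induction A rule: infinite_finite_induct) (auto intro: antiderivative_zero antiderivative_add)

text \<open>A factor \<open>h\<close> killed by the operator behaves like a constant, so
  \<open>a l ^ Suc p / Suc p\<close> times \<open>h\<close> works as in one variable.\<close>

lemma antiderivative_power_mult:
  assumes l: "l \<in> {1..r}" "l \<noteq> j"
    and h: "homogeneous_polynomial r e h" "pderiv_diff l j h = (\<lambda>_. 0)"
  shows "antiderivative r l j (p + e) (\<lambda>a. a l ^ p * h a)"
proof -
  note hp = polyfun_homogeneous[OF h(1)]
  have D: "pderiv_diff l j (\<lambda>a. a l ^ Suc p) = (\<lambda>a. real (Suc p) * a l ^ p)"
    using pderiv_diff_power[OF polyfun.var[OF l(1)], of l j p] l
    by (simp add: pderiv_diff_var unit_vec_def)
  have "homogeneous_polynomial r (0 + (Suc p * 1 + e)) (\<lambda>a. 1 / real (Suc p) * (a l ^ Suc p * h a))"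
    by (intro homogeneous_mult homogeneous_const homogeneous_power homogeneous_var l h)
  moreover have "pderiv_diff l j (\<lambda>a. 1 / real (Suc p) * (a l ^ Suc p * h a)) = (\<lambda>a. a l ^ p * h a)"
    by (subst pderiv_diff_mult[OF polyfun.const polyfun.mult[OF polyfun_power[OF polyfun.var] hp]], rule l,
        subst pderiv_diff_mult[OF polyfun_power[OF polyfun.var] hp], rule l)
      (simp only: D h(2), simp)
  ultimately show ?thesis
    unfolding antiderivative_def
    by (intro exI[of _ "\<lambda>a. 1 / real (Suc p) * (a l ^ Suc p * h a)"]) simp
qed

text \<open>The sum \<open>a\<^sub>l + a\<^sub>j\<close> is annihilated by \<open>\<partial>\<^sub>l - \<partial>\<^sub>j\<close>, so powers of \<open>a\<^sub>j = (a\<^sub>l + a\<^sub>j) - a\<^sub>l\<close> can be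
  traded for powers of \<open>a\<^sub>l\<close>.\<close>

lemma antiderivative_powers_mult:
  assumes l: "l \<in> {1..r}" "j \<in> {1..r}" "l \<noteq> j"
    and h: "homogeneous_polynomial r e h" "pderiv_diff l j h = (\<lambda>_. 0)"
  shows "antiderivative r l j (p + n + e) (\<lambda>a. a l ^ p * a j ^ n * h a)"
  using h
proof (induction n arbitrary: p e h)
  case 0
  then show ?case using antiderivative_power_mult[of l r j e h p] l by simp
next
  case (Suc n)
  note hp = polyfun_homogeneous[OF Suc.prems(1)]
  have c: "homogeneous_polynomial r 1 (\<lambda>a. a l + a j)"
    by (intro homogeneous_add homogeneous_var l)
  have "pderiv_diff l j (\<lambda>a. a l + a j) = (\<lambda>_. 0)"
    using l by (simp add: pderiv_diff_add[of r] polyfun.var pderiv_diff_var unit_vec_def)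
  then have "pderiv_diff l j (\<lambda>a. (a l + a j) * h a) = (\<lambda>_. 0)"
    using pderiv_diff_mult[OF polyfun_homogeneous[OF c] hp, of l j] Suc.prems(2) by simp
  from Suc.IH[OF homogeneous_mult[OF c Suc.prems(1)] this, of p]
  have 1: "antiderivative r l j (p + Suc n + e) (\<lambda>a. a l ^ p * a j ^ n * ((a l + a j) * h a))" by simp
  have 2: "antiderivative r l j (p + Suc n + e) (\<lambda>a. -1 * (a l ^ Suc p * a j ^ n * h a))"
    using antiderivative_cmult[OF Suc.IH[OF Suc.prems, of "Suc p"], of "-1"] by simp
  have "(\<lambda>a. a l ^ p * a j ^ Suc n * h a) =
    (\<lambda>a. a l ^ p * a j ^ n * ((a l + a j) * h a) + -1 * (a l ^ Suc p * a j ^ n * h a))"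
    by (simp add: algebra_simps)
  then show ?case using antiderivative_add[OF 1 2] by simp
qed

lemma pderiv_diff_prod_zero:
  assumes "finite A" "\<And>x. x \<in> A \<Longrightarrow> polyfun r (f x)" "\<And>x. x \<in> A \<Longrightarrow> pderiv_diff l j (f x) = (\<lambda>_. 0)"
  shows "pderiv_diff l j (\<lambda>a. \<Prod>x\<in>A. f x a) = (\<lambda>_. 0)"
  using assms
  by (induction A) (simp_all add: pderiv_diff_mult[of r] polyfun_prod)

text \<open>By linearity one monomial suffices. Its part \<open>?h\<close> free of the variables
  \<open>l\<close> and \<open>j\<close> is killed by the operator, which leaves only the powers of
  \<open>a l\<close> and \<open>a j\<close>.\<close>

lemma homogeneous_antiderivative:
  assumes l: "l \<in> {1..r}" "l < j" "j \<le> r + 1" and f: "homogeneous_polynomial r d f"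
  shows "antiderivative r l j d f"
proof -
  obtain S :: "(nat \<Rightarrow> nat) set" and b where
    S: "\<forall>\<alpha>\<in>S. (\<Sum>i = 1..r. \<alpha> i) = d" "f = (\<lambda>a. \<Sum>\<alpha>\<in>S. b \<alpha> * (\<Prod>i = 1..r. a i ^ \<alpha> i))"
    using f unfolding homogeneous_polynomial_def by blast
  have "antiderivative r l j d (\<lambda>a. \<Prod>i = 1..r. a i ^ \<alpha> i)" if \<alpha>: "(\<Sum>i = 1..r. \<alpha> i) = d" for \<alpha>
  proof -
    let ?\<beta> = "\<lambda>i. if i = l \<or> i = j then 0 else \<alpha> i"
    let ?h = "\<lambda>a. (\<Prod>i = 1..r. a i ^ ?\<beta> i) :: real"
    have h: "homogeneous_polynomial r (\<Sum>i = 1..r. ?\<beta> i) ?h"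
      using homogeneous_monomial[OF refl, where \<alpha> = ?\<beta> and r = r and c = 1] by simp
    have "pderiv_diff l j (\<lambda>a. a i ^ ?\<beta> i) = (\<lambda>_. 0)" if "i \<in> {1..r}" for i
    proof (cases "?\<beta> i")
      case (Suc k)
      then have "i \<noteq> l" "i \<noteq> j" by (auto split: if_splits)
      then show ?thesis unfolding Suc
        by (subst pderiv_diff_power[OF polyfun.var[OF that]])
          (simp add: pderiv_diff_var unit_vec_def)
    qed simp
    then have dh: "pderiv_diff l j ?h = (\<lambda>_. 0)"
      by (intro pderiv_diff_prod_zero[of _ r] polyfun_power polyfun.var) auto
    show ?thesis
    proof (cases "j \<le> r")
      case True
      then have I: "{1..r} = insert l (insert j ({1..r} - {l, j}))" using l by auto
      have e: "?h a = (\<Prod>i\<in>{1..r} - {l, j}. a i ^ \<alpha> i)" for a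
        by (intro prod.mono_neutral_cong_right) auto
      have s: "(\<Sum>i = 1..r. ?\<beta> i) = (\<Sum>i\<in>{1..r} - {l, j}. \<alpha> i)"
        by (intro sum.mono_neutral_cong_right) auto
      have "(\<Prod>i = 1..r. a i ^ \<alpha> i) = a l ^ \<alpha> l * a j ^ \<alpha> j * ?h a" for a :: "nat \<Rightarrow> real"
        unfolding e by (subst I) (use l in simp)
      moreover have "d = \<alpha> l + \<alpha> j + (\<Sum>i = 1..r. ?\<beta> i)"
        unfolding s \<alpha>[symmetric] by (subst I) (use l in simp)
      ultimately show ?thesis
        using antiderivative_powers_mult[OF _ _ _ h dh, of "\<alpha> l" "\<alpha> j"] l True by simp
    next
      \<comment> \<open>Here \<open>j = r + 1\<close>, so \<open>a j\<close> does not occur in the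
        monomial.\<close>
      case False
      then have I: "{1..r} = insert l ({1..r} - {l, j})" using l by auto
      have e: "?h a = (\<Prod>i\<in>{1..r} - {l, j}. a i ^ \<alpha> i)" for a
        by (intro prod.mono_neutral_cong_right) auto
      have s: "(\<Sum>i = 1..r. ?\<beta> i) = (\<Sum>i\<in>{1..r} - {l, j}. \<alpha> i)"
        by (intro sum.mono_neutral_cong_right) auto
      have "(\<Prod>i = 1..r. a i ^ \<alpha> i) = a l ^ \<alpha> l * ?h a" for a :: "nat \<Rightarrow> real"
        unfolding e by (subst I) (use l in simp)
      moreover have "d = \<alpha> l + (\<Sum>i = 1..r. ?\<beta> i)"
        unfolding s \<alpha>[symmetric] by (subst I) (use l in simp)
      ultimately show ?thesis
        using antiderivative_power_mult[OF _ _ h dh, of "\<alpha> l"] l by simp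
    qed
  qed
  then show ?thesis
    unfolding S(2) using S(1) by (intro antiderivative_sum antiderivative_cmult) auto
qed

section \<open>Volumes of flow regions\<close>

text \<open>When \<open>F\<close> consists of all edges except the \<open>(i, r + 1, 1)\<close>,
  flow conservation at \<open>i\<close> forces the edge \<open>(i, r + 1, 1)\<close> to carry
  exactly this amount.\<close>

definition excess :: "(nat \<times> nat \<times> nat) set \<Rightarrow> (nat \<Rightarrow> real) \<Rightarrow> (nat \<times> nat \<times> nat \<Rightarrow> real) \<Rightarrow> nat \<Rightarrow> real" where
  "excess F a y i = a i - (\<Sum>e\<in>F. y e * (unit_vec (fst e) i - unit_vec (fst (snd e)) i))"

text \<open>For the full set of free edges this is the polytope seen in the chart, the second
  condition being nonnegativity of the omitted edges. Arbitrary \<open>F\<close> are allowed so that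
  edges can be added one at a time.\<close>

definition flow_region :: "nat \<Rightarrow> (nat \<times> nat \<times> nat) set \<Rightarrow> (nat \<Rightarrow> real) \<Rightarrow> (nat \<times> nat \<times> nat \<Rightarrow> real) set" where
  "flow_region r F a =
     {y \<in> F \<rightarrow>\<^sub>E UNIV. (\<forall>e\<in>F. 0 \<le> y e) \<and> (\<forall>i\<in>{1..r}. 0 \<le> excess F a y i)}"

lemma excess_measurable [measurable]:
  "(\<lambda>y. excess F a y i) \<in> borel_measurable (Pi\<^sub>M F (\<lambda>_. lborel))"
  unfolding excess_def by measurable

lemma flow_region_sets [measurable]:
  assumes "finite F"
  shows "flow_region r F a \<in> sets (Pi\<^sub>M F (\<lambda>_. lborel))"
proof -
  have "flow_region r F a = {y \<in> space (Pi\<^sub>M F (\<lambda>_. lborel)).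
      (\<forall>e\<in>F. 0 \<le> y e) \<and> (\<forall>i\<in>{1..r}. 0 \<le> excess F a y i)}"
    by (auto simp: flow_region_def space_PiM)
  also have "\<dots> \<in> sets (Pi\<^sub>M F (\<lambda>_. lborel))"
    using assms by measurable
  finally show ?thesis .
qed

lemma flow_region_empty:
  assumes "\<forall>i\<in>{1..r}. 0 \<le> a i"
  shows "emeasure (Pi\<^sub>M {} (\<lambda>_. lborel)) (flow_region r {} a) = 1"
proof -
  have "flow_region r {} a = {\<lambda>_. undefined}"
    using assms by (auto simp: flow_region_def excess_def)
  then show ?thesis by (simp add: PiM_empty)
qed

text \<open>Sending \<open>t\<close> along the new edge has the same effect on the rest as moving an
  amount \<open>t\<close> of supply from \<open>l\<close> to \<open>j\<close>.\<close>

lemma excess_insert: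
  assumes "finite F" "(l, j, k) \<notin> F"
  shows "excess (insert (l, j, k) F) a (y((l, j, k) := t)) = excess F (shift l j a (- t)) y"
proof
  fix i
  have "(\<Sum>e\<in>F. (y((l, j, k) := t)) e * (unit_vec (fst e) i - unit_vec (fst (snd e)) i)) =
      (\<Sum>e\<in>F. y e * (unit_vec (fst e) i - unit_vec (fst (snd e)) i))"
    using assms(2) by (intro sum.cong) auto
  then show "excess (insert (l, j, k) F) a (y((l, j, k) := t)) i = excess F (shift l j a (- t)) y i"
    using assms by (simp add: excess_def shift_def)
qed

lemma flow_region_insert:
  assumes "finite F" "(l, j, k) \<notin> F" "y \<in> F \<rightarrow>\<^sub>E UNIV"
  shows "y((l, j, k) := t) \<in> flow_region r (insert (l, j, k) F) a \<longleftrightarrow>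
    0 \<le> t \<and> y \<in> flow_region r F (shift l j a (- t))"
proof -
  have "y((l, j, k) := t) \<in> insert (l, j, k) F \<rightarrow>\<^sub>E UNIV"
    using assms(3) by (auto simp: PiE_iff extensional_def)
  moreover have "(\<forall>e\<in>insert (l, j, k) F. 0 \<le> (y((l, j, k) := t)) e) \<longleftrightarrow> 0 \<le> t \<and> (\<forall>e\<in>F. 0 \<le> y e)"
    using assms(2) by auto
  ultimately show ?thesis
    using assms(3)
    by (simp only: flow_region_def mem_Collect_eq excess_insert[OF assms(1,2)] simp_thms conj_assoc)
qed

interpretation lborel_product: product_sigma_finite "\<lambda>_ :: 'i. lborel :: real measure"
  by standard

lemma emeasure_flow_region_insert:
  assumes "finite F" "(l, j, k) \<notin> F"
  shows "emeasure (Pi\<^sub>M (insert (l, j, k) F) (\<lambda>_. lborel)) (flow_region r (insert (l, j, k) F) a) =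
    (\<integral>\<^sup>+ t. indicator {0..} t *
      emeasure (Pi\<^sub>M F (\<lambda>_. lborel)) (flow_region r F (shift l j a (- t))) \<partial>lborel)"
proof -
  let ?e = "(l, j, k)"
  have [measurable]: "flow_region r (insert ?e F) a \<in> sets (Pi\<^sub>M (insert ?e F) (\<lambda>_. lborel))"
    using assms(1) by (intro flow_region_sets) simp
  have "emeasure (Pi\<^sub>M (insert ?e F) (\<lambda>_. lborel)) (flow_region r (insert ?e F) a) =
      (\<integral>\<^sup>+ y. indicator (flow_region r (insert ?e F) a) y \<partial>Pi\<^sub>M (insert ?e F) (\<lambda>_. lborel))"
    by simp
  also have "\<dots> = (\<integral>\<^sup>+ t. \<integral>\<^sup>+ y. indicator (flow_region r (insert ?e F) a) (y(?e := t))
      \<partial>Pi\<^sub>M F (\<lambda>_. lborel) \<partial>lborel)"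
    by (rule lborel_product.product_nn_integral_insert_rev[OF assms]) measurable
  also have "\<dots> = (\<integral>\<^sup>+ t. \<integral>\<^sup>+ y. indicator {0..} t * indicator (flow_region r F (shift l j a (- t))) y
      \<partial>Pi\<^sub>M F (\<lambda>_. lborel) \<partial>lborel)"
    by (intro nn_integral_cong)
      (auto simp: indicator_def space_PiM flow_region_insert[OF assms])
  also have "\<dots> = (\<integral>\<^sup>+ t. indicator {0..} t *
      emeasure (Pi\<^sub>M F (\<lambda>_. lborel)) (flow_region r F (shift l j a (- t))) \<partial>lborel)"
    using flow_region_sets[OF assms(1)]
    by (intro nn_integral_cong) (simp add: nn_integral_cmult)
  finally show ?thesis .
qed

text \<open>All targets exceed \<open>l\<close>, so no edge enters \<open>l\<close> and nothing can
  make up for a negative supply there. This cuts off the integral over the new edge at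
  \<open>a l\<close>.\<close>

lemma flow_region_negative:
  assumes "\<forall>e\<in>F. l \<le> fst e \<and> fst e < fst (snd e)" "l \<in> {1..r}" "a l < 0"
  shows "flow_region r F a = {}"
proof -
  have "excess F a y l < 0" if "\<forall>e\<in>F. 0 \<le> y e" for y
  proof -
    have "0 \<le> (\<Sum>e\<in>F. y e * (unit_vec (fst e) l - unit_vec (fst (snd e)) l))"
      using assms(1) that by (intro sum_nonneg) (force simp: unit_vec_def)
    then show ?thesis using assms(3) by (simp add: excess_def)
  qed
  then show ?thesis using assms(2) by (force simp: flow_region_def not_le[symmetric])
qed

text \<open>Nonnegativity is recorded because \<open>ennreal\<close> sends negative numbers to 0;
  with it the equation determines \<open>p\<close> on the orthant.\<close>

definition represents_volume :: "nat \<Rightarrow> (nat \<times> nat \<times> nat) set \<Rightarrow> ((nat \<Rightarrow> real) \<Rightarrow> real) \<Rightarrow> bool" where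
  "represents_volume r F p \<longleftrightarrow> homogeneous_polynomial r (card F) p \<and>
     (\<forall>a. (\<forall>i\<in>{1..r}. 0 \<le> a i) \<longrightarrow>
        0 \<le> p a \<and> emeasure (Pi\<^sub>M F (\<lambda>_. lborel)) (flow_region r F a) = ennreal (p a))"

text \<open>By Fubini the new volume at \<open>a\<close> is the integral of the old one along
  \<open>shift l j a (- t)\<close>. This integral effectively runs over
  \<open>0 \<le> t \<le> a l\<close>, where the old volume is \<open>p\<close>, and the fundamental
  theorem of calculus evaluates it to the antiderivative that vanishes on
  \<open>a l = 0\<close>.\<close>

lemma represents_volume_insert:
  assumes F: "finite F" "(l, j, k) \<notin> F" "\<forall>e\<in>F. l \<le> fst e \<and> fst e < fst (snd e)"
    and l: "l \<in> {1..r}" "l < j" "j \<le> r + 1"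
    and p: "represents_volume r F p"
  obtains g where "represents_volume r (insert (l, j, k) F) g" "pderiv_diff l j g = p"
    "\<And>a. a l = 0 \<Longrightarrow> g a = 0"
proof -
  have hom: "homogeneous_polynomial r (card F) p" using p by (simp add: represents_volume_def)
  from homogeneous_antiderivative[OF l hom] obtain g
    where g: "homogeneous_polynomial r (card F + 1) g" "pderiv_diff l j g = p" "\<And>a. a l = 0 \<Longrightarrow> g a = 0"
    unfolding antiderivative_def by blast
  have "0 \<le> g a \<and> emeasure (Pi\<^sub>M (insert (l, j, k) F) (\<lambda>_. lborel)) (flow_region r (insert (l, j, k) F) a) =
      ennreal (g a)" if a: "\<forall>i\<in>{1..r}. 0 \<le> a i" for a
  proof -
    have al: "0 \<le> a l" using a l by auto
    \<comment> \<open>Supply leaves \<open>l\<close> only as long as some is left, and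
      \<open>j\<close> can only gain, so the path stays in the orthant where \<open>p\<close> is the
      volume.\<close>
    have nonneg: "\<forall>i\<in>{1..r}. 0 \<le> shift l j a (- t) i" if "0 \<le> t" "t \<le> a l" for t
      using a that l by (auto simp: shift_def unit_vec_def intro: order_trans[of "- t" 0])
    have deriv: "((\<lambda>t. - g (shift l j a (- t))) has_real_derivative p (shift l j a (- t))) (at t)" for t
    proof -
      have "((\<lambda>s. g (shift l j a s)) has_real_derivative p (shift l j a (- t))) (at (- t))"
        using polyfun_has_derivative_along[OF polyfun_homogeneous[OF g(1)], of l j a "- t"]
        unfolding g(2) .
      from DERIV_minus[OF DERIV_chain2[OF this DERIV_minus[OF DERIV_ident]]]
      show ?thesis by simp
    qed
    have "((\<lambda>t. p (shift l j a (- t))) has_integral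
        (- g (shift l j a (- a l)) - - g (shift l j a (- 0)))) {0..a l}"
      using deriv al
      by (intro fundamental_theorem_of_calculus)
        (auto simp: has_real_derivative_iff_has_vector_derivative[symmetric] intro: DERIV_subset)
    \<comment> \<open>At the upper limit all supply has left \<open>l\<close>, so the boundary
      condition on \<open>g\<close> applies.\<close>
    moreover have "g (shift l j a (- a l)) = 0"
      using l by (intro g(3) shift_to_zero) auto
    moreover have "shift l j a (- 0) = a" by (simp add: shift_def)
    ultimately have int: "((\<lambda>t. p (shift l j a (- t))) has_integral g a) {0..a l}" by simp
    have pos: "0 \<le> p (shift l j a (- t))" if "t \<in> {0..a l}" for t
      using p nonneg[of t] that by (auto simp: represents_volume_def)
    have "indicator {0..} t * emeasure (Pi\<^sub>M F (\<lambda>_. lborel)) (flow_region r F (shift l j a (- t))) =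
        ennreal (indicator {0..a l} t * p (shift l j a (- t)))" for t
    proof -
      consider "t < 0" | "0 \<le> t" "t \<le> a l" | "0 \<le> t" "a l < t" by linarith
      then show ?thesis
      proof cases
        case 2
        then show ?thesis using p nonneg[of t] by (simp add: represents_volume_def)
      next
        case 3
        then have "shift l j a (- t) l < 0" using l by (simp add: shift_def unit_vec_def)
        then show ?thesis using 3 flow_region_negative[OF F(3) l(1)] by simp
      qed auto
    qed
    then have "emeasure (Pi\<^sub>M (insert (l, j, k) F) (\<lambda>_. lborel)) (flow_region r (insert (l, j, k) F) a) =
        (\<integral>\<^sup>+ t. ennreal (indicator {0..a l} t * p (shift l j a (- t))) \<partial>lborel)"
      unfolding emeasure_flow_region_insert[OF F(1,2)] by simp
    also have "\<dots> = ennreal (g a)"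
      by (rule nn_integral_has_integral_lebesgue[OF pos int])
    finally show ?thesis using has_integral_nonneg[OF int pos] by simp
  qed
  with g F(1,2) show ?thesis
    by (intro that[of g]) (simp_all add: represents_volume_def)
qed

section \<open>Differential operators and antiderivatives\<close>

text \<open>Only derivatives in indices other than \<open>l\<close> occur. They are taken along the
  hyperplane \<open>a l = 0\<close>, hence preserve vanishing there, and on polynomial functions
  they commute with all the operators considered.\<close>

inductive diff_operator :: "nat \<Rightarrow> (((nat \<Rightarrow> real) \<Rightarrow> real) \<Rightarrow> (nat \<Rightarrow> real) \<Rightarrow> real) \<Rightarrow> bool" for l where
  id: "diff_operator l id"
| at: "diff_operator l T \<Longrightarrow> i \<noteq> l \<Longrightarrow> diff_operator l (pderiv_at i \<circ> T)"
| diff: "diff_operator l T \<Longrightarrow> i \<noteq> l \<Longrightarrow> j \<noteq> l \<Longrightarrow> diff_operator l (pderiv_diff i j \<circ> T)"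

lemma diff_operator_comp:
  assumes "diff_operator l S" "diff_operator l T"
  shows "diff_operator l (S \<circ> T)"
  using assms by induction (simp_all add: comp_assoc diff_operator.at diff_operator.diff)

lemma diff_operator_pderiv_at: "i \<noteq> l \<Longrightarrow> diff_operator l (pderiv_at i)"
  using diff_operator.at[OF diff_operator.id] by simp

lemma diff_operator_pderiv_diff: "i \<noteq> l \<Longrightarrow> j \<noteq> l \<Longrightarrow> diff_operator l (pderiv_diff i j)"
  using diff_operator.diff[OF diff_operator.id] by simp

lemma diff_operator_funpow: "diff_operator l T \<Longrightarrow> diff_operator l (T ^^ n)"
  by (induction n) (simp_all add: diff_operator.id diff_operator_comp)

lemma diff_operator_foldr:
  assumes "diff_operator l T" "\<And>x. x \<in> set xs \<Longrightarrow> diff_operator l (S x)"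
  shows "diff_operator l (foldr (\<lambda>x D. S x \<circ> D) xs T)"
  using assms by (induction xs) (simp_all add: diff_operator_comp)

lemma polyfun_diff_operator: "diff_operator l T \<Longrightarrow> polyfun r f \<Longrightarrow> polyfun r (T f)"
  by (induction rule: diff_operator.induct) (simp_all add: polyfun_pderiv_at polyfun_pderiv_diff)

lemma diff_operator_pderiv_at_commute:
  assumes "diff_operator l T" "polyfun r f"
  shows "T (pderiv_at k f) = pderiv_at k (T f)"
  using assms
  by (induction rule: diff_operator.induct)
    (simp_all add: polyfun_diff_operator pderiv_at_commute[of r _ k] pderiv_at_pderiv_diff[of r _ k])

lemma diff_operator_pderiv_diff_commute:
  assumes "diff_operator l T" "polyfun r f"
  shows "T (pderiv_diff k n f) = pderiv_diff k n (T f)"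
  using assms
  by (induction rule: diff_operator.induct)
    (simp_all add: polyfun_diff_operator pderiv_at_pderiv_diff[of r] pderiv_diff_commute[of r _ _ _ k])

lemma pderiv_at_vanish:
  assumes "i \<noteq> l" "\<And>a. a l = 0 \<Longrightarrow> f a = 0" "a l = 0"
  shows "pderiv_at i f a = 0"
proof -
  have "(\<lambda>t. f (a(i := t))) = (\<lambda>_. 0)" using assms by auto
  then show ?thesis by (simp add: pderiv_at_def)
qed

lemma diff_operator_vanish:
  assumes "diff_operator l T" "\<And>a. a l = 0 \<Longrightarrow> f a = 0" "a l = 0"
  shows "T f a = 0"
  using assms(1,3)
proof (induction arbitrary: a)
  case id
  then show ?case using assms(2) by simp
next
  case (at T i)
  then show ?case using pderiv_at_vanish[of i l "T f"] by simp
next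
  case (diff T i j)
  then show ?case
    using pderiv_at_vanish[of i l "T f"] pderiv_at_vanish[of j l "T f"] by (simp add: pderiv_diff_def)
qed

text \<open>This is how an equation passes from a volume to its antiderivative \<open>g\<close>:
  \<open>T g\<close> vanishes on \<open>a l = 0\<close> and, by commutation, has derivative zero
  along \<open>e_l - e_j\<close>, so uniqueness applies.\<close>

lemma diff_operator_antiderivative:
  assumes "diff_operator l T" "polyfun r g" "l \<noteq> j" "\<And>a. a l = 0 \<Longrightarrow> g a = 0"
    and "T (pderiv_diff l j g) = (\<lambda>_. 0)"
  shows "T g = (\<lambda>_. 0)"
proof (rule pderiv_diff_unique)
  show "polyfun r (T g)" using assms(1,2) by (rule polyfun_diff_operator)
  show "pderiv_diff l j (T g) = (\<lambda>_. 0)"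
    using diff_operator_pderiv_diff_commute[OF assms(1,2)] assms(5) by simp
  show "T g a = 0" if "a l = 0" for a
    using diff_operator_vanish[of l T g a] assms(1,4) that by simp
qed (rule assms(3))

section \<open>The quotient measure\<close>

text \<open>One edge to the sink is set aside for each vertex. The roots of these edges form the
  lattice basis used for \<open>da\<close>, which makes the change of variables unimodular.\<close>

definition free_edges :: "nat \<Rightarrow> (nat \<Rightarrow> nat \<Rightarrow> nat) \<Rightarrow> (nat \<times> nat \<times> nat) set" where
  "free_edges r m = flow_index r m - (\<lambda>i. (i, r + 1, 1)) ` {1..r}"

text \<open>The inverse of the chart that restricts a flow to the free edges: conservation fills in
  the omitted edges, and \<open>fst e\<close> is the vertex that such an edge leaves.\<close>

definition complete_flow :: "nat \<Rightarrow> (nat \<Rightarrow> nat \<Rightarrow> nat) \<Rightarrow> (nat \<times> nat \<times> nat \<Rightarrow> real) \<Rightarrow> (nat \<Rightarrow> real) \<Rightarrow>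
    nat \<times> nat \<times> nat \<Rightarrow> real" where
  "complete_flow r m y a =
     (\<lambda>e\<in>flow_index r m. if e \<in> free_edges r m then y e else excess (free_edges r m) a y (fst e))"

lemma flow_index_Sigma:
  "flow_index r m = Sigma {1..r} (\<lambda>i. Sigma {i + 1..r + 1} (\<lambda>j. {1..m i j}))"
  by (auto simp: flow_index_def)

lemma finite_flow_index [simp]: "finite (flow_index r m)"
  by (simp add: flow_index_Sigma)

lemma card_flow_index: "card (flow_index r m) = flow_dim r m"
  by (simp add: flow_index_Sigma flow_dim_def)

lemma finite_free_edges [simp]: "finite (free_edges r m)"
  by (simp add: free_edges_def)

lemma excess_restrict [simp]: "excess F a (restrict y F) = excess F a y"
  by (auto simp: excess_def)

lemma excess_cong: "(\<And>e. e \<in> F \<Longrightarrow> y e = z e) \<Longrightarrow> a i = b i \<Longrightarrow> excess F a y i = excess F b z i"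
  by (simp add: excess_def)

lemma excess_add: "excess F a y i + excess F (\<lambda>_. 0) z i = excess F a (\<lambda>e. y e + z e) i"
  by (simp add: excess_def distrib_right sum.distrib)

lemma excess_zero: "excess F a y i = a i + excess F (\<lambda>_. 0) y i"
  by (simp add: excess_def)

lemma root_space_eqI:
  assumes "a \<in> root_space r" "b \<in> root_space r" "\<And>i. i \<in> {1..r} \<Longrightarrow> a i = b i"
  shows "a = b"
proof -
  have "sum a {1..r} = sum b {1..r}" using assms(3) by (rule sum.cong[OF refl])
  then have "a (r + 1) = b (r + 1)" using assms(1,2) by (simp add: root_space_def)
  moreover have "i \<in> {1..r} \<or> i = r + 1" if "i \<in> {1..r + 1}" for i using that by auto
  ultimately show ?thesis
    using assms(1,2,3) unfolding root_space_def by (intro PiE_ext[of a "{1..r + 1}" "\<lambda>_. UNIV" b]) blast+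
qed

lemma zero_root_space: "(\<lambda>k\<in>{1..r + 1}. 0) \<in> root_space r"
  by (simp add: root_space_def)

lemma sum_unit_vec: "i \<in> A \<Longrightarrow> finite A \<Longrightarrow> (\<Sum>v\<in>A. unit_vec i v) = 1"
  by (simp add: unit_vec_def)

lemma flow_map_root_space: "flow_map r m y \<in> root_space r"
proof -
  have "(\<Sum>v = 1..r + 1. flow_map r m y v) =
      (\<Sum>e\<in>flow_index r m. \<Sum>v = 1..r + 1. y e * (unit_vec (fst e) v - unit_vec (fst (snd e)) v))"
    unfolding flow_map_def by (subst sum.swap) (simp add: case_prod_beta)
  also have "\<dots> = 0"
  proof (rule sum.neutral, rule ballI)
    fix e assume e: "e \<in> flow_index r m"
    then have "fst e \<in> {1..r + 1}" "fst (snd e) \<in> {1..r + 1}" by (auto simp: flow_index_def)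
    then show "(\<Sum>v = 1..r + 1. y e * (unit_vec (fst e) v - unit_vec (fst (snd e)) v)) = 0"
      unfolding sum_distrib_left[symmetric] sum_subtractf by (simp only: sum_unit_vec finite_atLeastAtMost) simp
  qed
  finally show ?thesis by (simp add: root_space_def flow_map_def)
qed

lemma chamber_vec_nth: "i \<in> {1..r} \<Longrightarrow> chamber_vec r a i = a i"
  by (auto simp: chamber_vec_def unit_vec_def if_distrib[of "\<lambda>x. _ * x"] cong: if_cong)

lemma chamber_vec_root_space: "chamber_vec r a \<in> root_space r"
proof -
  have "(\<Sum>v = 1..r + 1. chamber_vec r a v) =
      (\<Sum>i = 1..r. \<Sum>v = 1..r + 1. a i * (unit_vec i v - unit_vec (r + 1) v))"
    unfolding chamber_vec_def by (subst sum.swap) simp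
  also have "\<dots> = 0"
  proof (rule sum.neutral, rule ballI)
    fix i assume "i \<in> {1..r}"
    then have "i \<in> {1..r + 1}" "r + 1 \<in> {1..r + 1}" by auto
    then show "(\<Sum>v = 1..r + 1. a i * (unit_vec i v - unit_vec (r + 1) v)) = 0"
      unfolding sum_distrib_left[symmetric] sum_subtractf by (simp only: sum_unit_vec finite_atLeastAtMost) simp
  qed
  finally show ?thesis by (simp add: root_space_def chamber_vec_def)
qed

section \<open>Translation invariance of Lebesgue measure\<close>

lemma emeasure_lborel_translate:
  fixes A :: "real set"
  assumes "A \<in> sets borel"
  shows "emeasure lborel {t. c + t \<in> A} = emeasure lborel A"
proof -
  have "emeasure lborel A = emeasure (distr lborel borel ((+) c)) A"
    using lborel_distr_plus[of c] by simp
  also have "\<dots> = emeasure lborel ((+) c -` A \<inter> space lborel)"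
    using assms by (intro emeasure_distr) auto
  also have "(+) c -` A \<inter> space lborel = {t. c + t \<in> A}" by auto
  finally show ?thesis by simp
qed

lemma sets_lborel_translate [measurable]:
  fixes A :: "real set"
  assumes "A \<in> sets borel"
  shows "{t. c + t \<in> A} \<in> sets borel"
  using measurable_sets[of "(+) c" borel borel A] assms by (simp add: vimage_def)

lemma distr_PiM_lborel_translate:
  fixes c :: "'i \<Rightarrow> real"
  assumes "finite F"
  shows "distr (Pi\<^sub>M F (\<lambda>_. lborel)) (Pi\<^sub>M F (\<lambda>_. lborel)) (\<lambda>y. \<lambda>e\<in>F. c e + y e) = Pi\<^sub>M F (\<lambda>_. lborel)"
proof (rule lborel_product.PiM_eqI[OF assms])
  fix A :: "'i \<Rightarrow> real set" assume A: "\<And>e. e \<in> F \<Longrightarrow> A e \<in> sets lborel"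
  have T: "(\<lambda>y. \<lambda>e\<in>F. c e + y e) \<in> Pi\<^sub>M F (\<lambda>_. lborel) \<rightarrow>\<^sub>M Pi\<^sub>M F (\<lambda>_. lborel)"
    by measurable
  have "emeasure (distr (Pi\<^sub>M F (\<lambda>_. lborel)) (Pi\<^sub>M F (\<lambda>_. lborel)) (\<lambda>y. \<lambda>e\<in>F. c e + y e)) (Pi\<^sub>E F A) =
      emeasure (Pi\<^sub>M F (\<lambda>_. lborel)) ((\<lambda>y. \<lambda>e\<in>F. c e + y e) -` Pi\<^sub>E F A \<inter> space (Pi\<^sub>M F (\<lambda>_. lborel)))"
    using A assms by (intro emeasure_distr[OF T] sets_PiM_I_finite) auto
  also have "(\<lambda>y. \<lambda>e\<in>F. c e + y e) -` Pi\<^sub>E F A \<inter> space (Pi\<^sub>M F (\<lambda>_. lborel)) =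
      Pi\<^sub>E F (\<lambda>e. {t. c e + t \<in> A e})"
    by (auto simp: space_PiM PiE_iff)
  also have "emeasure (Pi\<^sub>M F (\<lambda>_. lborel)) \<dots> = (\<Prod>e\<in>F. emeasure lborel {t. c e + t \<in> A e})"
    using A assms by (intro lborel_product.emeasure_PiM) auto
  also have "\<dots> = (\<Prod>e\<in>F. emeasure lborel (A e))"
    using A by (intro prod.cong emeasure_lborel_translate) auto
  finally show "emeasure (distr (Pi\<^sub>M F (\<lambda>_. lborel)) (Pi\<^sub>M F (\<lambda>_. lborel)) (\<lambda>y. \<lambda>e\<in>F. c e + y e)) (Pi\<^sub>E F A) =
      (\<Prod>e\<in>F. emeasure lborel (A e))" .
qed simp

section \<open>The fibres and their quotient measure in the chart of free edges\<close>

context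
  fixes r :: nat and m :: "nat \<Rightarrow> nat \<Rightarrow> nat"
  assumes pos: "\<And>i. i \<in> {1..r} \<Longrightarrow> 0 < m i (r + 1)"
begin

private abbreviation "E \<equiv> flow_index r m"
private abbreviation "F \<equiv> free_edges r m"
private abbreviation "LF \<equiv> Pi\<^sub>M F (\<lambda>_. lborel :: real measure)"
private abbreviation "LX \<equiv> Pi\<^sub>M {1..r} (\<lambda>_. lborel :: real measure)"
private abbreviation "fibre_space a \<equiv> restrict_space (flow_space r m) (flow_fibre r m a)"
private abbreviation "zero_vec \<equiv> \<lambda>k\<in>{1..r + 1}. 0 :: real"

lemma flow_index_split: "E = F \<union> (\<lambda>i. (i, r + 1, 1)) ` {1..r}"
  using pos by (force simp: free_edges_def flow_index_def)

lemma free_edges_disjoint: "F \<inter> (\<lambda>i. (i, r + 1, 1)) ` {1..r} = {}"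
  by (auto simp: free_edges_def)

lemma basis_edge_notin: "i \<in> {1..r} \<Longrightarrow> (i, r + 1, 1) \<notin> F"
  by (auto simp: free_edges_def)

lemma basis_edge_in: "i \<in> {1..r} \<Longrightarrow> (i, r + 1, 1) \<in> E"
  by (subst flow_index_split) auto

lemma free_edges_subset: "F \<subseteq> E"
  by (auto simp: free_edges_def)

lemma flow_index_cases:
  assumes "e \<in> E"
  obtains "e \<in> F" | i where "i \<in> {1..r}" "e = (i, r + 1, 1)"
  using assms flow_index_split by auto

lemma card_free_edges: "card F = flow_dim r m - r"
proof -
  have "card E = card F + card ((\<lambda>i. (i, r + 1, 1 :: nat)) ` {1..r})"
    by (subst flow_index_split, rule card_Un_disjoint) (use free_edges_disjoint in auto)
  also have "card ((\<lambda>i. (i, r + 1, 1 :: nat)) ` {1..r}) = r"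
    by (subst card_image) (auto simp: inj_on_def)
  finally show ?thesis by (simp add: card_flow_index)
qed

lemma flow_map_nth:
  assumes "i \<in> {1..r}"
  shows "flow_map r m y i = y (i, r + 1, 1) - excess F (\<lambda>_. 0) y i"
proof -
  let ?f = "\<lambda>e. y e * (unit_vec (fst e) i - unit_vec (fst (snd e)) i)"
  have "flow_map r m y i = sum ?f E" using assms by (simp add: flow_map_def case_prod_beta)
  also have "\<dots> = sum ?f F + sum ?f ((\<lambda>i. (i, r + 1, 1)) ` {1..r})"
    by (subst flow_index_split, rule sum.union_disjoint) (use free_edges_disjoint in auto)
  also have "sum ?f ((\<lambda>i. (i, r + 1, 1)) ` {1..r}) =
      (\<Sum>k\<in>{1..r}. y (k, r + 1, 1) * (unit_vec k i - unit_vec (r + 1) i))"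
    by (subst sum.reindex) (auto simp: inj_on_def)
  also have "\<dots> = y (i, r + 1, 1)"
    using assms by (simp add: unit_vec_def if_distrib[of "\<lambda>x. _ * x"] cong: if_cong)
  finally show ?thesis by (simp add: excess_def)
qed

text \<open>The fibre is a graph over the free coordinates. Conservation is required at
  \<open>1, ..., r\<close> only, since coordinates in \<open>root_space\<close> sum to zero and the
  last one follows.\<close>

lemma flow_fibre_iff:
  assumes "a \<in> root_space r"
  shows "y \<in> flow_fibre r m a \<longleftrightarrow>
    y \<in> E \<rightarrow>\<^sub>E UNIV \<and> (\<forall>i\<in>{1..r}. y (i, r + 1, 1) = excess F a y i)"
proof -
  have "flow_map r m y = a \<longleftrightarrow> (\<forall>i\<in>{1..r}. flow_map r m y i = a i)"
    using root_space_eqI[OF flow_map_root_space assms] by auto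
  also have "\<dots> \<longleftrightarrow> (\<forall>i\<in>{1..r}. y (i, r + 1, 1) = excess F a y i)"
  proof (intro ball_cong refl)
    fix i assume "i \<in> {1..r}"
    then show "flow_map r m y i = a i \<longleftrightarrow> y (i, r + 1, 1) = excess F a y i"
      unfolding flow_map_nth[OF \<open>i \<in> {1..r}\<close>] excess_zero[of F a] by linarith
  qed
  finally show ?thesis by (simp add: flow_fibre_def)
qed

lemma complete_flow_free: "e \<in> F \<Longrightarrow> complete_flow r m y a e = y e"
  using free_edges_subset by (auto simp: complete_flow_def)

lemma complete_flow_basis:
  "i \<in> {1..r} \<Longrightarrow> complete_flow r m y a (i, r + 1, 1) = excess F a y i"
  using basis_edge_in[of i] basis_edge_notin[of i] by (simp add: complete_flow_def)

lemma complete_flow_eqI: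
  assumes "z \<in> E \<rightarrow>\<^sub>E UNIV" "\<And>e. e \<in> F \<Longrightarrow> z e = y e"
    "\<And>i. i \<in> {1..r} \<Longrightarrow> z (i, r + 1, 1) = excess F a y i"
  shows "z = complete_flow r m y a"
proof (rule PiE_ext[OF assms(1)])
  show "complete_flow r m y a \<in> E \<rightarrow>\<^sub>E UNIV" by (simp add: complete_flow_def)
  fix e assume "e \<in> E"
  then show "z e = complete_flow r m y a e"
    by (cases rule: flow_index_cases) (simp_all only: complete_flow_free complete_flow_basis assms)
qed

lemma complete_flow_in_fibre:
  assumes "a \<in> root_space r"
  shows "complete_flow r m y a \<in> flow_fibre r m a"
  unfolding flow_fibre_iff[OF assms]
proof (intro conjI ballI)
  show "complete_flow r m y a \<in> E \<rightarrow>\<^sub>E UNIV" by (simp add: complete_flow_def)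
  show "complete_flow r m y a (i, r + 1, 1) = excess F a (complete_flow r m y a) i" if "i \<in> {1..r}" for i
    unfolding complete_flow_basis[OF that] by (rule excess_cong) (simp_all add: complete_flow_free)
qed

text \<open>This allows \<open>a\<close> to be either a vector of \<open>root_space r\<close> or a
  point of the parameter space over \<open>{1..r}\<close>.\<close>

lemma complete_flow_cong:
  assumes "\<And>i. i \<in> {1..r} \<Longrightarrow> a i = b i"
  shows "complete_flow r m y a = complete_flow r m y b"
proof (rule complete_flow_eqI)
  show "complete_flow r m y a \<in> E \<rightarrow>\<^sub>E UNIV" by (simp add: complete_flow_def)
  show "complete_flow r m y a (i, r + 1, 1) = excess F b y i" if "i \<in> {1..r}" for i
    unfolding complete_flow_basis[OF that] by (rule excess_cong) (use assms that in auto)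
qed (rule complete_flow_free)

lemma complete_flow_measurable:
  assumes N: "\<And>i. i \<in> {1..r} \<Longrightarrow> (\<lambda>w. a w i) \<in> borel_measurable N"
    and y: "\<And>e. e \<in> F \<Longrightarrow> (\<lambda>w. y w e) \<in> borel_measurable N"
  shows "(\<lambda>w. complete_flow r m (y w) (a w)) \<in> N \<rightarrow>\<^sub>M flow_space r m"
  unfolding flow_space_def complete_flow_def
proof (rule measurable_restrict)
  fix e assume "e \<in> E"
  then show "(\<lambda>w. if e \<in> F then y w e else excess F (a w) (y w) (fst e)) \<in> N \<rightarrow>\<^sub>M lborel"
  proof (cases rule: flow_index_cases)
    case 1
    then show ?thesis using y by simp
  next
    case (2 i)
    have "(\<lambda>w. excess F (a w) (y w) i) \<in> borel_measurable N"
      unfolding excess_def using N[OF 2(1)] y by measurable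
    then show ?thesis using 2 basis_edge_notin[OF 2(1)] by simp
  qed
qed

lemma complete_flow_pair_measurable:
  "(\<lambda>(y, x). complete_flow r m y x) \<in> LF \<Otimes>\<^sub>M LX \<rightarrow>\<^sub>M flow_space r m"
proof -
  have "(\<lambda>w. complete_flow r m (fst w) (snd w)) \<in> LF \<Otimes>\<^sub>M LX \<rightarrow>\<^sub>M flow_space r m"
    by (rule complete_flow_measurable)
      (auto intro!: measurable_compose[OF measurable_snd] measurable_compose[OF measurable_fst]
        measurable_component_singleton[where M = "\<lambda>_. lborel", simplified])
  then show ?thesis by (simp add: case_prod_beta)
qed

lemma complete_flow_fibre_measurable:
  assumes "a \<in> root_space r"
  shows "(\<lambda>y. complete_flow r m y a) \<in> LF \<rightarrow>\<^sub>M fibre_space a"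
  by (intro measurable_restrict_space2 complete_flow_measurable)
    (auto simp: complete_flow_in_fibre[OF assms])

lemma pair_sigma_finite_LF_LX: "pair_sigma_finite LF LX"
proof -
  interpret LF: finite_product_sigma_finite "\<lambda>_. lborel" F by standard simp
  interpret LX: finite_product_sigma_finite "\<lambda>_ :: nat. lborel" "{1..r}" by standard simp
  show ?thesis by standard
qed

text \<open>The change of variables is unimodular: for fixed \<open>y\<close> it translates \<open>x\<close> by an amount depending on \<open>y\<close>.\<close>

lemma distr_complete_flow:
  "distr (LF \<Otimes>\<^sub>M LX) (flow_space r m) (\<lambda>(y, x). complete_flow r m y x) = flow_space r m"
  unfolding flow_space_def
proof (rule lborel_product.PiM_eqI)
  interpret pair_sigma_finite LF LX by (rule pair_sigma_finite_LF_LX)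
  fix A :: "nat \<times> nat \<times> nat \<Rightarrow> real set"
  assume A: "\<And>e. e \<in> E \<Longrightarrow> A e \<in> sets lborel"
  let ?T = "\<lambda>(y, x). complete_flow r m y x"
  let ?S = "?T -` Pi\<^sub>E E A \<inter> space (LF \<Otimes>\<^sub>M LX)"
  let ?K = "\<Prod>i\<in>{1..r}. emeasure lborel (A (i, r + 1, 1))"
  note T = complete_flow_pair_measurable[unfolded flow_space_def]
  have EA: "Pi\<^sub>E E A \<in> sets (Pi\<^sub>M E (\<lambda>_. lborel))" using A by (intro sets_PiM_I_finite) auto
  have FA: "Pi\<^sub>E F A \<in> sets LF" using A free_edges_subset by (intro sets_PiM_I_finite) auto
  have S: "?S \<in> sets (LF \<Otimes>\<^sub>M LX)" by (rule measurable_sets[OF T EA])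
  have "emeasure (distr (LF \<Otimes>\<^sub>M LX) (Pi\<^sub>M E (\<lambda>_. lborel)) ?T) (Pi\<^sub>E E A) = emeasure (LF \<Otimes>\<^sub>M LX) ?S"
    by (rule emeasure_distr[OF T EA])
  also have "\<dots> = (\<integral>\<^sup>+ y. emeasure LX (Pair y -` ?S) \<partial>LF)"
    by (rule M2.emeasure_pair_measure_alt[OF S])
  also have "\<dots> = (\<integral>\<^sup>+ y. indicator (Pi\<^sub>E F A) y * ?K \<partial>LF)"
  proof (rule nn_integral_cong)
    fix y assume y: "y \<in> space LF"
    let ?c = "excess F (\<lambda>_. 0) y"
    have "Pair y -` ?S = (if y \<in> Pi\<^sub>E F A then Pi\<^sub>E {1..r} (\<lambda>i. {t. ?c i + t \<in> A (i, r + 1, 1)}) else {})"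
    proof -
      have "complete_flow r m y x \<in> Pi\<^sub>E E A \<longleftrightarrow>
          y \<in> Pi\<^sub>E F A \<and> (\<forall>i\<in>{1..r}. ?c i + x i \<in> A (i, r + 1, 1))" for x
      proof -
        have "complete_flow r m y x \<in> Pi\<^sub>E E A \<longleftrightarrow> (\<forall>e\<in>E. complete_flow r m y x e \<in> A e)"
          by (simp add: PiE_iff complete_flow_def)
        also have "\<dots> \<longleftrightarrow> (\<forall>e\<in>F. complete_flow r m y x e \<in> A e) \<and>
            (\<forall>i\<in>{1..r}. complete_flow r m y x (i, r + 1, 1) \<in> A (i, r + 1, 1))"
          by (subst flow_index_split) blast
        also have "\<dots> \<longleftrightarrow> (\<forall>e\<in>F. y e \<in> A e) \<and> (\<forall>i\<in>{1..r}. ?c i + x i \<in> A (i, r + 1, 1))"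
        proof -
          have "complete_flow r m y x (i, r + 1, 1) = ?c i + x i" if "i \<in> {1..r}" for i
            unfolding complete_flow_basis[OF that] excess_zero[of F x] by simp
          then show ?thesis by (simp only: complete_flow_free cong: ball_cong)
        qed
        also have "(\<forall>e\<in>F. y e \<in> A e) \<longleftrightarrow> y \<in> Pi\<^sub>E F A"
          using y by (auto simp: space_PiM PiE_iff)
        finally show ?thesis .
      qed
      then show ?thesis using y by (auto simp: space_pair_measure space_PiM PiE_iff)
    qed
    moreover have "emeasure LX (Pi\<^sub>E {1..r} (\<lambda>i. {t. ?c i + t \<in> A (i, r + 1, 1)})) = ?K"
    proof -
      have A': "A (i, r + 1, 1) \<in> sets borel" if "i \<in> {1..r}" for i
        using A[OF basis_edge_in[OF that]] by simp
      have "emeasure LX (Pi\<^sub>E {1..r} (\<lambda>i. {t. ?c i + t \<in> A (i, r + 1, 1)})) =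
          (\<Prod>i\<in>{1..r}. emeasure lborel {t. ?c i + t \<in> A (i, r + 1, 1)})"
        using A' sets_lborel_translate by (intro lborel_product.emeasure_PiM) auto
      also have "\<dots> = ?K"
        using A' by (intro prod.cong emeasure_lborel_translate) auto
      finally show ?thesis .
    qed
    ultimately show "emeasure LX (Pair y -` ?S) = indicator (Pi\<^sub>E F A) y * ?K"
      by simp
  qed
  also have "\<dots> = emeasure LF (Pi\<^sub>E F A) * ?K"
    using FA by (simp add: nn_integral_multc)
  also have "emeasure LF (Pi\<^sub>E F A) = (\<Prod>e\<in>F. emeasure lborel (A e))"
    using A free_edges_subset by (intro lborel_product.emeasure_PiM) auto
  also have "?K = (\<Prod>e\<in>(\<lambda>i. (i, r + 1, 1)) ` {1..r}. emeasure lborel (A e))"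
    by (subst prod.reindex) (auto simp: inj_on_def)
  also have "(\<Prod>e\<in>F. emeasure lborel (A e)) * \<dots> = (\<Prod>e\<in>E. emeasure lborel (A e))"
    unfolding flow_index_split
    by (rule prod.union_disjoint[symmetric]) (use free_edges_disjoint in auto)
  finally show "emeasure (distr (LF \<Otimes>\<^sub>M LX) (Pi\<^sub>M E (\<lambda>_. lborel)) ?T) (Pi\<^sub>E E A) =
      (\<Prod>e\<in>E. emeasure lborel (A e))" .
qed simp_all

lemma emeasure_flow_space:
  assumes "A \<in> sets (flow_space r m)"
  shows "emeasure (flow_space r m) A =
    emeasure (LF \<Otimes>\<^sub>M LX) ((\<lambda>(y, x). complete_flow r m y x) -` A \<inter> space (LF \<Otimes>\<^sub>M LX))"
  by (subst distr_complete_flow[symmetric], rule emeasure_distr[OF complete_flow_pair_measurable assms])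

lemma translate_measurable:
  assumes a: "a \<in> root_space r" and u: "u \<in> flow_fibre r m a"
  shows "(\<lambda>n. \<lambda>e\<in>E. u e + n e) \<in> fibre_space zero_vec \<rightarrow>\<^sub>M fibre_space a"
proof (rule measurable_restrict_space2)
  show "(\<lambda>n. \<lambda>e\<in>E. u e + n e) \<in> space (fibre_space zero_vec) \<rightarrow> flow_fibre r m a"
  proof
    fix n assume "n \<in> space (fibre_space zero_vec)"
    then have n: "n \<in> flow_fibre r m zero_vec" by (simp add: space_restrict_space)
    show "(\<lambda>e\<in>E. u e + n e) \<in> flow_fibre r m a"
      unfolding flow_fibre_iff[OF a]
    proof (intro conjI ballI)
      fix i assume i: "i \<in> {1..r}"
      have "excess F zero_vec n i = excess F (\<lambda>_. 0) n i" using i by (intro excess_cong) auto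
      then have "u (i, r + 1, 1) + n (i, r + 1, 1) = excess F a u i + excess F (\<lambda>_. 0) n i"
        using u n i unfolding flow_fibre_iff[OF a] flow_fibre_iff[OF zero_root_space] by simp
      also have "\<dots> = excess F a (\<lambda>e\<in>E. u e + n e) i"
        unfolding excess_add using free_edges_subset by (intro excess_cong) auto
      finally show "(\<lambda>e\<in>E. u e + n e) (i, r + 1, 1) = excess F a (\<lambda>e\<in>E. u e + n e) i"
        using basis_edge_in[OF i] by simp
    qed simp
  qed
  show "(\<lambda>n. \<lambda>e\<in>E. u e + n e) \<in> fibre_space zero_vec \<rightarrow>\<^sub>M flow_space r m"
    unfolding flow_space_def by (intro measurable_restrict_space1) measurable
qed

lemma chamber_vec_measurable:
  "chamber_vec r \<in> LX \<rightarrow>\<^sub>M restrict_space (Pi\<^sub>M {1..r + 1} (\<lambda>_. borel)) (root_space r)"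
proof (rule measurable_restrict_space2)
  show "chamber_vec r \<in> LX \<rightarrow>\<^sub>M Pi\<^sub>M {1..r + 1} (\<lambda>_. borel)"
    unfolding chamber_vec_def[abs_def] by (intro measurable_restrict) measurable
qed (simp add: chamber_vec_root_space)

text \<open>The witness transports Lebesgue measure on the free coordinates to each fibre. Its
  invariance is that of Lebesgue measure, and the disintegration is Fubini after the unimodular
  change of variables.\<close>

lemma quotient_measure_exists: "\<exists>\<mu>. is_quotient_measure r m \<mu>"
proof -
  let ?\<mu> = "\<lambda>a. distr LF (fibre_space a) (\<lambda>y. complete_flow r m y a)"
  have "is_quotient_measure r m ?\<mu>"
    unfolding is_quotient_measure_def
  proof (intro conjI ballI)
    fix a u assume a: "a \<in> root_space r" and u: "u \<in> flow_fibre r m a"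
    have "distr (?\<mu> zero_vec) (fibre_space a) (\<lambda>n. \<lambda>e\<in>E. u e + n e) =
        distr LF (fibre_space a) ((\<lambda>n. \<lambda>e\<in>E. u e + n e) \<circ> (\<lambda>y. complete_flow r m y zero_vec))"
      by (rule distr_distr[OF translate_measurable[OF a u] complete_flow_fibre_measurable[OF zero_root_space]])
    \<comment> \<open>In the chart, translation by \<open>u\<close> from the kernel to the fibre
      over \<open>a\<close> is translation by the free coordinates of \<open>u\<close>.\<close>
    also have "(\<lambda>n. \<lambda>e\<in>E. u e + n e) \<circ> (\<lambda>y. complete_flow r m y zero_vec) =
        (\<lambda>y. complete_flow r m y a) \<circ> (\<lambda>y. \<lambda>e\<in>F. u e + y e)"
    proof
      fix y
      have "(\<lambda>e\<in>E. u e + complete_flow r m y zero_vec e) = complete_flow r m (\<lambda>e\<in>F. u e + y e) a"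
      proof (rule complete_flow_eqI)
        show "(\<lambda>e\<in>E. u e + complete_flow r m y zero_vec e) e = (\<lambda>e\<in>F. u e + y e) e" if "e \<in> F" for e
          using that free_edges_subset by (auto simp: complete_flow_free)
        fix i assume i: "i \<in> {1..r}"
        have "excess F zero_vec y i = excess F (\<lambda>_. 0) y i" using i by (intro excess_cong) auto
        then have "u (i, r + 1, 1) + complete_flow r m y zero_vec (i, r + 1, 1) =
            excess F a u i + excess F (\<lambda>_. 0) y i"
          using u i unfolding flow_fibre_iff[OF a] complete_flow_basis[OF i] by simp
        then show "(\<lambda>e\<in>E. u e + complete_flow r m y zero_vec e) (i, r + 1, 1) =
            excess F a (\<lambda>e\<in>F. u e + y e) i"
          using basis_edge_in[OF i] by (simp add: excess_add)
      qed simp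
      then show "((\<lambda>n. \<lambda>e\<in>E. u e + n e) \<circ> (\<lambda>y. complete_flow r m y zero_vec)) y =
          ((\<lambda>y. complete_flow r m y a) \<circ> (\<lambda>y. \<lambda>e\<in>F. u e + y e)) y" by simp
    qed
    also have "distr LF (fibre_space a) \<dots> =
        distr (distr LF LF (\<lambda>y. \<lambda>e\<in>F. u e + y e)) (fibre_space a) (\<lambda>y. complete_flow r m y a)"
      by (rule distr_distr[symmetric, OF complete_flow_fibre_measurable[OF a]]) measurable
    also have "\<dots> = ?\<mu> a" by (simp add: distr_PiM_lborel_translate)
    finally show "?\<mu> a = distr (?\<mu> zero_vec) (fibre_space a) (\<lambda>n. \<lambda>e\<in>E. u e + n e)" ..
  next
    fix A assume A: "A \<in> sets (flow_space r m)"
    interpret pair_sigma_finite LF LX by (rule pair_sigma_finite_LF_LX)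
    let ?S = "(\<lambda>(y, x). complete_flow r m y x) -` A \<inter> space (LF \<Otimes>\<^sub>M LX)"
    let ?G = "\<lambda>x. emeasure LF ((\<lambda>y. (y, x)) -` ?S)"
    let ?R = "restrict_space (Pi\<^sub>M {1..r + 1} (\<lambda>_. borel)) (root_space r) :: (nat \<Rightarrow> real) measure"
    have S: "?S \<in> sets (LF \<Otimes>\<^sub>M LX)" by (rule measurable_sets[OF complete_flow_pair_measurable A])
    \<comment> \<open>The fibre measure of \<open>A\<close> is the measure of a slice of
      \<open>?S\<close>. Writing the slice in terms of the first \<open>r\<close> coordinates of
      \<open>a\<close> also yields measurability in \<open>a\<close>.\<close>
    have G: "emeasure (?\<mu> a) (A \<inter> flow_fibre r m a) = ?G (restrict a {1..r})" if a: "a \<in> root_space r" for a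
    proof -
      have A': "A \<inter> flow_fibre r m a \<in> sets (fibre_space a)"
        using A by (auto simp: sets_restrict_space)
      have "emeasure (?\<mu> a) (A \<inter> flow_fibre r m a) =
          emeasure LF ((\<lambda>y. complete_flow r m y a) -` (A \<inter> flow_fibre r m a) \<inter> space LF)"
        by (rule emeasure_distr[OF complete_flow_fibre_measurable[OF a] A'])
      also have "(\<lambda>y. complete_flow r m y a) -` (A \<inter> flow_fibre r m a) \<inter> space LF =
          (\<lambda>y. (y, restrict a {1..r})) -` ?S"
        using complete_flow_in_fibre[OF a] complete_flow_cong[of "restrict a {1..r}" a]
        by (auto simp: space_pair_measure space_PiM)
      finally show ?thesis .
    qed
    have restrict: "(\<lambda>a. restrict a {1..r}) \<in> ?R \<rightarrow>\<^sub>M LX"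
      by (intro measurable_restrict_space1 measurable_restrict) measurable
    have "(\<lambda>a. ?G (restrict a {1..r})) \<in> borel_measurable ?R"
      by (rule measurable_compose[OF restrict measurable_emeasure_Pair2[OF S]])
    moreover have "space ?R = root_space r"
      by (auto simp: space_restrict_space space_PiM root_space_def)
    ultimately have meas: "(\<lambda>a. emeasure (?\<mu> a) (A \<inter> flow_fibre r m a)) \<in> borel_measurable ?R"
      using G by (subst measurable_cong[where g = "\<lambda>a. ?G (restrict a {1..r})"]) auto
    have "emeasure (flow_space r m) A = (\<integral>\<^sup>+ x. ?G x \<partial>LX)"
      unfolding emeasure_flow_space[OF A] by (rule emeasure_pair_measure_alt2[OF S])
    also have "\<dots> = (\<integral>\<^sup>+ x. emeasure (?\<mu> (chamber_vec r x)) (A \<inter> flow_fibre r m (chamber_vec r x)) \<partial>LX)"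
    proof (rule nn_integral_cong)
      fix x assume x: "x \<in> space LX"
      have "restrict (chamber_vec r x) {1..r} = x"
        using x by (intro ext) (auto simp: chamber_vec_nth space_PiM PiE_iff extensional_def)
      then show "?G x = emeasure (?\<mu> (chamber_vec r x)) (A \<inter> flow_fibre r m (chamber_vec r x))"
        using G[OF chamber_vec_root_space[of r x]] by simp
    qed
    also have "\<dots> = (\<integral>\<^sup>+ a. emeasure (?\<mu> a) (A \<inter> flow_fibre r m a) \<partial>root_measure r)"
      unfolding root_measure_def
      by (rule nn_integral_distr[OF chamber_vec_measurable, symmetric]) (use meas in simp)
    finally show "emeasure (flow_space r m) A =
        (\<integral>\<^sup>+ a. emeasure (?\<mu> a) (A \<inter> flow_fibre r m a) \<partial>root_measure r)" .
  qed simp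
  then show ?thesis by blast
qed

text \<open>By translation invariance the left-hand side does not depend on \<open>a\<close>, so it can be computed by
  averaging over the unit cube of parameters.\<close>

lemma emeasure_quotient_measure:
  assumes \<mu>: "is_quotient_measure r m \<mu>" and a: "a \<in> root_space r" and C: "C \<in> sets LF"
  shows "emeasure (\<mu> a) {y \<in> flow_fibre r m a. restrict y F \<in> C} = emeasure LF C"
proof -
  let ?P = "\<lambda>a. {y \<in> flow_fibre r m a. restrict y F \<in> C}"
  define K where "K = emeasure (\<mu> zero_vec) (?P zero_vec)"
  have res: "(\<lambda>y. restrict y F) \<in> flow_space r m \<rightarrow>\<^sub>M LF"
    unfolding flow_space_def by (rule measurable_restrict_subset[OF free_edges_subset])
  have P: "?P a \<in> sets (fibre_space a)" for a
  proof -
    have "?P a = flow_fibre r m a \<inter> ((\<lambda>y. restrict y F) -` C \<inter> space (flow_space r m))"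
      by (auto simp: flow_fibre_def flow_space_def space_PiM)
    then show ?thesis
      using measurable_sets[OF res C] by (auto simp: sets_restrict_space)
  qed
  have const: "emeasure (\<mu> a) (?P a) = K" if a: "a \<in> root_space r" for a
  proof -
    \<comment> \<open>All free coordinates of this base point are 0, so translating by it leaves the
      free coordinates unchanged and matches \<open>?P zero_vec\<close> with
      \<open>?P a\<close>.\<close>
    let ?u = "complete_flow r m (\<lambda>_. 0) a"
    let ?T = "\<lambda>n. \<lambda>e\<in>E. ?u e + n e"
    note u = complete_flow_in_fibre[OF a, of "\<lambda>_. 0"]
    have sets0: "sets (\<mu> zero_vec) = sets (fibre_space zero_vec)"
      using \<mu> zero_root_space unfolding is_quotient_measure_def by blast
    then have space0: "space (\<mu> zero_vec) = flow_fibre r m zero_vec"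
      by (auto dest!: sets_eq_imp_space_eq simp: space_restrict_space flow_fibre_def flow_space_def space_PiM)
    have T: "?T \<in> \<mu> zero_vec \<rightarrow>\<^sub>M fibre_space a"
      using translate_measurable[OF a u] measurable_cong_sets[OF sets0 refl] by blast
    have "\<mu> a = distr (\<mu> zero_vec) (fibre_space a) ?T"
      using \<mu> a u unfolding is_quotient_measure_def by blast
    then have "emeasure (\<mu> a) (?P a) = emeasure (\<mu> zero_vec) (?T -` ?P a \<inter> space (\<mu> zero_vec))"
      using emeasure_distr[OF T P] by simp
    also have "?T -` ?P a \<inter> space (\<mu> zero_vec) = ?P zero_vec"
    proof -
      have "restrict (?T n) F = restrict n F" for n
        using subsetD[OF free_edges_subset] by (intro ext) (simp add: complete_flow_free restrict_def)
      moreover have "?T n \<in> flow_fibre r m a" if "n \<in> flow_fibre r m zero_vec" for n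
        using measurable_space[OF T] that unfolding space0 by (auto simp: space_restrict_space)
      ultimately show ?thesis unfolding space0 by auto
    qed
    finally show ?thesis unfolding K_def .
  qed
  \<comment> \<open>Free coordinates in \<open>C\<close> and image parameters in the unit cube. The
    chart gives \<open>A\<close> the measure of \<open>C\<close>, since the cube has measure 1;
    disintegration gives it the measure \<open>K\<close>.\<close>
  define A where "A = {y \<in> space (flow_space r m). restrict y F \<in> C \<and>
    (\<forall>i\<in>{1..r}. y (i, r + 1, 1) - excess F (\<lambda>_. 0) y i \<in> {0..1})}"
  let ?Q = "{a \<in> root_space r. \<forall>i\<in>{1..r}. a i \<in> {0..1}}"
  let ?I = "Pi\<^sub>E {1..r} (\<lambda>_. {0..1 :: real})"
  have A: "A \<in> sets (flow_space r m)"
  proof -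
    have "(\<lambda>y. y (i, r + 1, 1) - excess F (\<lambda>_. 0) y i) \<in> borel_measurable (flow_space r m)"
      if "i \<in> {1..r}" for i
    proof -
      have "(\<lambda>y. y e) \<in> borel_measurable (flow_space r m)" if "e \<in> E" for e
        unfolding flow_space_def using measurable_component_singleton[OF that, of "\<lambda>_. lborel"] by simp
      then show ?thesis
        unfolding excess_def using free_edges_subset basis_edge_in[OF that]
        by (intro borel_measurable_diff borel_measurable_sum borel_measurable_times) auto
    qed
    note [measurable] = this
    have "{y \<in> space (flow_space r m). \<forall>i\<in>{1..r}. y (i, r + 1, 1) - excess F (\<lambda>_. 0) y i \<in> {0..1}}
        \<in> sets (flow_space r m)"
      by measurable
    moreover have "A = ((\<lambda>y. restrict y F) -` C \<inter> space (flow_space r m)) \<inter>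
        {y \<in> space (flow_space r m). \<forall>i\<in>{1..r}. y (i, r + 1, 1) - excess F (\<lambda>_. 0) y i \<in> {0..1}}"
      by (auto simp: A_def)
    ultimately show ?thesis using measurable_sets[OF res C] by auto
  qed
  have Q: "?Q \<in> sets (restrict_space (Pi\<^sub>M {1..r + 1} (\<lambda>_. borel)) (root_space r))"
  proof -
    have "?Q = root_space r \<inter> {a \<in> space (Pi\<^sub>M {1..r + 1} (\<lambda>_. borel)). \<forall>i\<in>{1..r}. a i \<in> {0..1}}"
      by (auto simp: root_space_def space_PiM)
    moreover have "{a \<in> space (Pi\<^sub>M {1..r + 1} (\<lambda>_. borel)). \<forall>i\<in>{1..r}. a i \<in> {0..1 :: real}}
        \<in> sets (Pi\<^sub>M {1..r + 1} (\<lambda>_. borel))"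
      by measurable
    ultimately show ?thesis by (auto simp: sets_restrict_space)
  qed
  have cube: "emeasure LX ?I = 1"
    by (subst lborel_product.emeasure_PiM) auto
  have I: "?I \<in> sets LX" by (intro sets_PiM_I_finite) auto
  have "emeasure (root_measure r) ?Q = emeasure LX (chamber_vec r -` ?Q \<inter> space LX)"
    unfolding root_measure_def by (rule emeasure_distr[OF chamber_vec_measurable Q])
  also have "chamber_vec r -` ?Q \<inter> space LX = ?I"
    by (auto simp: chamber_vec_nth chamber_vec_root_space space_PiM PiE_iff)
  finally have root: "emeasure (root_measure r) ?Q = 1" using cube by simp
  have "emeasure LF C = emeasure (LF \<Otimes>\<^sub>M LX) (C \<times> ?I)"
  proof -
    interpret pair_sigma_finite LF LX by (rule pair_sigma_finite_LF_LX)
    show ?thesis using M2.emeasure_pair_measure_Times[OF C I] cube by simp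
  qed
  also have "C \<times> ?I = (\<lambda>(y, x). complete_flow r m y x) -` A \<inter> space (LF \<Otimes>\<^sub>M LX)"
  proof -
    have A_iff: "complete_flow r m y x \<in> A \<longleftrightarrow> y \<in> C \<and> (\<forall>i\<in>{1..r}. x i \<in> {0..1})"
      if y: "y \<in> space LF" for x y
    proof -
      have diff: "complete_flow r m y x (i, r + 1, 1) - excess F (\<lambda>_. 0) (complete_flow r m y x) i = x i"
        if "i \<in> {1..r}" for i
      proof -
        have "excess F (\<lambda>_. 0) (complete_flow r m y x) i = excess F (\<lambda>_. 0) y i"
          by (rule excess_cong) (simp_all add: complete_flow_free)
        then show ?thesis unfolding complete_flow_basis[OF that] excess_zero[of F x] by simp
      qed
      have "(\<forall>i\<in>{1..r}. complete_flow r m y x (i, r + 1, 1) -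
          excess F (\<lambda>_. 0) (complete_flow r m y x) i \<in> {0..1}) \<longleftrightarrow> (\<forall>i\<in>{1..r}. x i \<in> {0..1})"
        by (rule ball_cong) (simp_all only: diff)
      moreover have "complete_flow r m y x \<in> space (flow_space r m)"
        by (simp add: flow_space_def space_PiM complete_flow_def)
      moreover have "restrict (complete_flow r m y x) F = y"
        using y by (intro ext) (auto simp: complete_flow_free space_PiM PiE_iff extensional_def restrict_def)
      ultimately show ?thesis unfolding A_def by simp
    qed
    have I_iff: "x \<in> ?I \<longleftrightarrow> x \<in> space LX \<and> (\<forall>i\<in>{1..r}. x i \<in> {0..1})" for x
      by (auto simp: space_PiM PiE_iff)
    have "(y, x) \<in> C \<times> ?I \<longleftrightarrow>
        (y, x) \<in> (\<lambda>(y, x). complete_flow r m y x) -` A \<inter> space (LF \<Otimes>\<^sub>M LX)" for y x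
      unfolding space_pair_measure Int_iff vimage_eq mem_Sigma_iff prod.case I_iff
      using sets.sets_into_space[OF C] A_iff[of y x] by blast
    then show ?thesis by (simp only: set_eq_iff split_paired_All) blast
  qed
  also have "emeasure (LF \<Otimes>\<^sub>M LX) \<dots> = emeasure (flow_space r m) A"
    by (rule emeasure_flow_space[OF A, symmetric])
  also have "\<dots> = (\<integral>\<^sup>+ a. emeasure (\<mu> a) (A \<inter> flow_fibre r m a) \<partial>root_measure r)"
    using \<mu> A unfolding is_quotient_measure_def by blast
  \<comment> \<open>Over a fixed \<open>a\<close> the cube condition involves \<open>a\<close>
    alone, so the integrand is \<open>K\<close> on the cube and 0 elsewhere.\<close>
  also have "\<dots> = (\<integral>\<^sup>+ a. K * indicator ?Q a \<partial>root_measure r)"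
  proof (rule nn_integral_cong)
    fix a assume "a \<in> space (root_measure r)"
    then have a: "a \<in> root_space r" by (simp add: root_measure_def space_restrict_space)
    have diff: "y (i, r + 1, 1) - excess F (\<lambda>_. 0) y i = a i" if "y \<in> flow_fibre r m a" "i \<in> {1..r}" for y i
      using that(1) unfolding flow_fibre_def flow_map_nth[OF that(2), symmetric] by simp
    have "y \<in> A \<longleftrightarrow> restrict y F \<in> C \<and> a \<in> ?Q" if y: "y \<in> flow_fibre r m a" for y
    proof -
      have "(\<forall>i\<in>{1..r}. y (i, r + 1, 1) - excess F (\<lambda>_. 0) y i \<in> {0..1}) \<longleftrightarrow> (\<forall>i\<in>{1..r}. a i \<in> {0..1})"
        by (rule ball_cong) (simp_all only: diff[OF y])
      moreover have "y \<in> space (flow_space r m)"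
        using y by (simp add: flow_space_def space_PiM flow_fibre_def)
      ultimately show ?thesis using a by (simp add: A_def)
    qed
    then have "A \<inter> flow_fibre r m a = (if a \<in> ?Q then ?P a else {})" by auto
    then show "emeasure (\<mu> a) (A \<inter> flow_fibre r m a) = K * indicator ?Q a"
      using const[OF a] by simp
  qed
  also have "\<dots> = K"
    using Q root by (subst nn_integral_cmult_indicator) (simp_all add: root_measure_def)
  finally show ?thesis using const[OF a] by simp
qed

text \<open>In the chart the polytope is the flow region of the free edges. The preceding evaluation
  holds for every quotient measure, in particular for the one picked by \<open>SOME\<close>.\<close>

lemma flow_volume_eq:
  "flow_volume r m (chamber_vec r a) = measure LF (flow_region r F a)"
proof -
  let ?a = "chamber_vec r a"
  have \<mu>: "is_quotient_measure r m (quotient_measure r m)"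
    unfolding quotient_measure_def using quotient_measure_exists by (rule someI_ex)
  have "flow_polytope r m ?a = {y \<in> flow_fibre r m ?a. restrict y F \<in> flow_region r F a}"
    unfolding flow_polytope_def
  proof (intro Collect_cong conj_cong refl)
    fix y assume y: "y \<in> flow_fibre r m ?a"
    have y_basis: "y (i, r + 1, 1) = excess F a y i" if "i \<in> {1..r}" for i
    proof -
      have "excess F ?a y i = excess F a y i" by (rule excess_cong) (simp_all only: chamber_vec_nth[OF that])
      then show ?thesis using y that unfolding flow_fibre_iff[OF chamber_vec_root_space] by simp
    qed
    have "(\<forall>e\<in>E. 0 \<le> y e) \<longleftrightarrow> (\<forall>e\<in>F. 0 \<le> y e) \<and> (\<forall>i\<in>{1..r}. 0 \<le> y (i, r + 1, 1))"
      by (subst flow_index_split) blast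
    moreover have "(\<forall>i\<in>{1..r}. 0 \<le> y (i, r + 1, 1)) \<longleftrightarrow> (\<forall>i\<in>{1..r}. 0 \<le> excess F a y i)"
      by (rule ball_cong) (simp_all only: y_basis)
    ultimately show "(\<forall>e\<in>E. 0 \<le> y e) \<longleftrightarrow> restrict y F \<in> flow_region r F a"
      by (simp add: flow_region_def)
  qed
  then show ?thesis
    unfolding flow_volume_def measure_def
    using emeasure_quotient_measure[OF \<mu> chamber_vec_root_space flow_region_sets[OF finite_free_edges]]
    by simp
qed

end

section \<open>The system of differential equations\<close>

lemma foldr_comp_append:
  "foldr (\<lambda>j D. S j \<circ> D) xs T = foldr (\<lambda>j D. S j \<circ> D) xs id \<circ> T"
  by (induction xs) (simp_all add: comp_assoc)

text \<open>The operator of index \<open>l'\<close> involves only indices from \<open>l'\<close>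
  upwards.\<close>

lemma diff_operator_flow_operator:
  assumes "l < l'"
  shows "diff_operator l (flow_operator r m l')"
  unfolding flow_operator_def
  using assms
  by (intro diff_operator_foldr diff_operator_funpow diff_operator_pderiv_at diff_operator_pderiv_diff) auto

lemma funpow_pderiv_diff_outside:
  assumes "polyfun r f"
  shows "(pderiv_diff l (r + 1) ^^ n) f = (pderiv_at l ^^ n) f"
    and "polyfun r ((pderiv_at l ^^ n) f)"
  by (induction n) (use assms in \<open>simp_all add: pderiv_diff_outside[simplified] polyfun_pderiv_at\<close>)

text \<open>In such a set no edge enters \<open>l\<close>, as \<open>flow_region_negative\<close>
  requires.\<close>

definition edges_above :: "nat \<Rightarrow> (nat \<times> nat \<times> nat) set \<Rightarrow> bool" where
  "edges_above l F \<longleftrightarrow> finite F \<and> (\<forall>e\<in>F. l \<le> fst e \<and> fst e < fst (snd e))"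

text \<open>Adding an edge \<open>(l, j, k)\<close> integrates along \<open>e\<^sub>l - e\<^sub>j\<close>; equations not involving \<open>\<partial>\<^sub>l\<close> survive.\<close>

definition extends_by :: "nat \<Rightarrow> (((nat \<Rightarrow> real) \<Rightarrow> real) \<Rightarrow> (nat \<Rightarrow> real) \<Rightarrow> real) \<Rightarrow>
    ((nat \<Rightarrow> real) \<Rightarrow> real) \<Rightarrow> ((nat \<Rightarrow> real) \<Rightarrow> real) \<Rightarrow> bool" where
  "extends_by l S p g \<longleftrightarrow> S g = p \<and>
     (\<forall>T. diff_operator l T \<longrightarrow> T p = (\<lambda>_. 0) \<longrightarrow> T g = (\<lambda>_. 0))"

lemma extends_by_id: "extends_by l id p p"
  by (simp add: extends_by_def)

text \<open>The step made last is undone first, so its operator \<open>T\<close> stands on the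
  inside of the composition.\<close>

lemma extends_by_trans:
  "extends_by l S p q \<Longrightarrow> extends_by l T q g \<Longrightarrow> extends_by l (S \<circ> T) p g"
  by (auto simp: extends_by_def)

lemma represents_volume_polyfun: "represents_volume r F p \<Longrightarrow> polyfun r p"
  by (auto simp: represents_volume_def intro: polyfun_homogeneous)

text \<open>Parallel edges are added one by one; each takes one antiderivative, hence the power
  \<open>card K\<close>.\<close>

lemma represents_volume_add_edges:
  assumes "finite K" "edges_above l F" "F \<inter> (\<lambda>k. (l, j, k)) ` K = {}"
    and l: "l \<in> {1..r}" "l < j" "j \<le> r + 1"
    and p: "represents_volume r F p"
  shows "\<exists>g. represents_volume r (F \<union> (\<lambda>k. (l, j, k)) ` K) g \<and>
    extends_by l (pderiv_diff l j ^^ card K) p g"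
  using assms(1,3)
proof (induction K)
  case empty
  then show ?case using p extends_by_id[unfolded id_def] by (intro exI[of _ p]) (simp add: id_def)
next
  case (insert k K)
  have "F \<inter> (\<lambda>k. (l, j, k)) ` K = {}" using insert.prems by auto
  from insert.IH[OF this] obtain q where q: "represents_volume r (F \<union> (\<lambda>k. (l, j, k)) ` K) q"
    "extends_by l (pderiv_diff l j ^^ card K) p q" by blast
  have "finite (F \<union> (\<lambda>k. (l, j, k)) ` K)" "(l, j, k) \<notin> F \<union> (\<lambda>k. (l, j, k)) ` K"
    "\<forall>e\<in>F \<union> (\<lambda>k. (l, j, k)) ` K. l \<le> fst e \<and> fst e < fst (snd e)"
    using insert.hyps insert.prems assms(2) l by (auto simp: edges_above_def)
  from represents_volume_insert[OF this l q(1)] obtain g where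
    g: "represents_volume r (insert (l, j, k) (F \<union> (\<lambda>k. (l, j, k)) ` K)) g" "pderiv_diff l j g = q"
      "\<And>a. a l = 0 \<Longrightarrow> g a = 0" by blast
  have "extends_by l (pderiv_diff l j) q g"
    unfolding extends_by_def
  proof (intro conjI allI impI)
    fix T assume "diff_operator l T" "T q = (\<lambda>_. 0)"
    then show "T g = (\<lambda>_. 0)"
      using g(2,3) l(2) represents_volume_polyfun[OF g(1)]
      by (intro diff_operator_antiderivative[of l T r g j]) auto
  qed (rule g(2))
  from extends_by_trans[OF q(2) this]
  have "extends_by l (pderiv_diff l j ^^ card (insert k K)) p g"
    using insert.hyps by (simp add: funpow_Suc_right del: funpow.simps)
  then show ?case using g(1) by (intro exI[of _ g]) simp
qed

text \<open>Targets are added in increasing order: undoing the last one first yields the composite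
  in the order of the \<open>foldr\<close> in \<open>flow_operator\<close>.\<close>

lemma represents_volume_add_targets:
  assumes F: "edges_above (l + 1) F" and l: "l \<in> {1..r}" and n: "l \<le> n" "n \<le> r"
    and p: "represents_volume r F p"
  shows "\<exists>g. represents_volume r (F \<union> {(i, j, k). i = l \<and> l < j \<and> j \<le> n \<and> 1 \<le> k \<and> k \<le> m l j}) g \<and>
    extends_by l (foldr (\<lambda>j D. (pderiv_diff l j ^^ m l j) \<circ> D) [l + 1..<n + 1] id) p g"
  using n
proof (induction n rule: dec_induct)
  case base
  have none: "{(i, j, k). i = l \<and> l < j \<and> j \<le> l \<and> 1 \<le> k \<and> k \<le> m l j} = {}" "[l + 1..<l + 1] = []"
    by auto
  show ?case
    unfolding none Un_empty_right foldr_Nil id_apply using p extends_by_id[unfolded id_def] by blast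
next
  case (step n)
  let ?G = "F \<union> {(i, j, k). i = l \<and> l < j \<and> j \<le> n \<and> 1 \<le> k \<and> k \<le> m l j}"
  let ?D = "\<lambda>n. foldr (\<lambda>j D. (pderiv_diff l j ^^ m l j) \<circ> D) [l + 1..<n + 1]"
  from step.IH step.prems obtain q where q: "represents_volume r ?G q" "extends_by l (?D n id) p q"
    using Suc_leD by blast
  have "finite {(i, j, k). i = l \<and> l < j \<and> j \<le> n \<and> 1 \<le> k \<and> k \<le> m l j}"
    by (rule finite_subset[of _ "{l} \<times> Sigma {..n} (\<lambda>j. {..m l j})"]) auto
  then have above: "edges_above l ?G" and disjoint: "?G \<inter> (\<lambda>k. (l, Suc n, k)) ` {1..m l (Suc n)} = {}"
    using F by (auto simp: edges_above_def)
  have bounds: "l < Suc n" "Suc n \<le> r + 1" and card: "card {1..m l (Suc n)} = m l (Suc n)"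
    using step.hyps step.prems by auto
  obtain g where g: "represents_volume r (?G \<union> (\<lambda>k. (l, Suc n, k)) ` {1..m l (Suc n)}) g"
    "extends_by l (pderiv_diff l (Suc n) ^^ m l (Suc n)) q g"
    using represents_volume_add_edges[OF finite_atLeastAtMost above disjoint l bounds q(1)]
    unfolding card by blast
  have edges: "?G \<union> (\<lambda>k. (l, Suc n, k)) ` {1..m l (Suc n)} =
      F \<union> {(i, j, k). i = l \<and> l < j \<and> j \<le> Suc n \<and> 1 \<le> k \<and> k \<le> m l j}"
    using step.hyps by (auto simp: le_Suc_eq)
  have "[l + 1..<Suc n + 1] = [l + 1..<n + 1] @ [Suc n]" using step.hyps by simp
  then have "?D (Suc n) id = ?D n (pderiv_diff l (Suc n) ^^ m l (Suc n))"
    by (simp only: foldr_append) simp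
  also have "\<dots> = ?D n id \<circ> (pderiv_diff l (Suc n) ^^ m l (Suc n))" by (rule foldr_comp_append)
  finally have ops: "?D (Suc n) id = ?D n id \<circ> (pderiv_diff l (Suc n) ^^ m l (Suc n))" .
  show ?case
  proof (intro exI conjI)
    show "represents_volume r (F \<union> {(i, j, k). i = l \<and> l < j \<and> j \<le> Suc n \<and> 1 \<le> k \<and> k \<le> m l j}) g"
      using g(1) unfolding edges .
    show "extends_by l (?D (Suc n) id) p g"
      unfolding ops by (rule extends_by_trans[OF q(2) g(2)])
  qed
qed

section \<open>Adding all free edges by descending source\<close>

definition edges_from :: "nat \<Rightarrow> (nat \<Rightarrow> nat \<Rightarrow> nat) \<Rightarrow> nat \<Rightarrow> (nat \<times> nat \<times> nat) set" where
  "edges_from r m l = {e \<in> free_edges r m. l \<le> fst e}"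

lemma edges_above_edges_from: "edges_above l (edges_from r m l)"
  using finite_free_edges[of r m]
  by (auto simp: edges_above_def edges_from_def free_edges_def flow_index_def)

text \<open>The labels of edges into the sink start at 2, because label 1 belongs to the omitted
  edge of vertex \<open>l\<close>.\<close>

lemma edges_from_Suc:
  assumes "l \<in> {1..r}"
  shows "edges_from r m l =
    (edges_from r m (l + 1) \<union> {(i, j, k). i = l \<and> l < j \<and> j \<le> r \<and> 1 \<le> k \<and> k \<le> m l j}) \<union>
    (\<lambda>k. (l, r + 1, k)) ` {2..m l (r + 1)}"
proof -
  have "edges_from r m l = edges_from r m (l + 1) \<union> {e \<in> free_edges r m. fst e = l}"
    by (auto simp: edges_from_def)
  also have "{e \<in> free_edges r m. fst e = l} =
      {(i, j, k). i = l \<and> l < j \<and> j \<le> r \<and> 1 \<le> k \<and> k \<le> m l j} \<union>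
      (\<lambda>k. (l, r + 1, k)) ` {2..m l (r + 1)}"
    using assms by (auto simp: free_edges_def flow_index_def image_iff le_Suc_eq)
  finally show ?thesis by (simp only: Un_assoc)
qed

text \<open>Descending induction on \<open>l\<close>. The last conjunct says that \<open>p\<close>
  does not involve the variables below \<open>l\<close>; at the next source this makes the surplus
  derivative vanish.\<close>

lemma represents_volume_edges_from:
  assumes pos: "\<And>i. i \<in> {1..r} \<Longrightarrow> 0 < m i (r + 1)" and "1 \<le> l" "l \<le> r + 1"
  shows "\<exists>p. represents_volume r (edges_from r m l) p \<and>
    (\<forall>l'\<in>{l..r}. flow_operator r m l' p = (\<lambda>_. 0)) \<and> (\<forall>i\<in>{1..<l}. pderiv_at i p = (\<lambda>_. 0))"
  using assms(3,2)
proof (induction l rule: inc_induct)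
  case base
  have "edges_from r m (r + 1) = {}"
    by (auto simp: edges_from_def free_edges_def flow_index_def)
  then have "represents_volume r (edges_from r m (r + 1)) (\<lambda>_. 1)"
    using homogeneous_const[of r 1] by (simp add: represents_volume_def flow_region_empty)
  then show ?case by (intro exI[of _ "\<lambda>_. 1"]) auto
next
  case (step l)
  let ?F = "edges_from r m (l + 1)"
  let ?G = "?F \<union> {(i, j, k). i = l \<and> l < j \<and> j \<le> r \<and> 1 \<le> k \<and> k \<le> m l j}"
  let ?D = "foldr (\<lambda>j D. (pderiv_diff l j ^^ m l j) \<circ> D) [l + 1..<r + 1]"
  have l: "l \<in> {1..r}" using step.hyps step.prems by auto
  from step obtain p where p: "represents_volume r ?F p"
    "\<And>l'. l' \<in> {l + 1..r} \<Longrightarrow> flow_operator r m l' p = (\<lambda>_. 0)"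
    "\<And>i. i \<in> {1..l} \<Longrightarrow> pderiv_at i p = (\<lambda>_. 0)" by (auto simp: less_Suc_eq_le)
  from represents_volume_add_targets[OF edges_above_edges_from l _ _ p(1), of r m] l
  obtain q where q: "represents_volume r ?G q" "extends_by l (?D id) p q" by auto
  have "finite {(i, j, k). i = l \<and> l < j \<and> j \<le> r \<and> 1 \<le> k \<and> k \<le> m l j}"
    by (rule finite_subset[of _ "{l} \<times> Sigma {..r} (\<lambda>j. {..m l j})"]) auto
  then have "edges_above l ?G"
    using edges_above_edges_from[of "l + 1" r m] by (auto simp: edges_above_def)
  moreover have "?G \<inter> (\<lambda>k. (l, r + 1, k)) ` {2..m l (r + 1)} = {}"
    by (auto simp: edges_from_def)
  moreover have "l < r + 1" "card {2..m l (r + 1)} = m l (r + 1) - 1" using l by auto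
  ultimately obtain g where g: "represents_volume r (edges_from r m l) g"
    "extends_by l (pderiv_diff l (r + 1) ^^ (m l (r + 1) - 1)) q g"
    using represents_volume_add_edges[of "{2..m l (r + 1)}" l ?G "r + 1" r q] l q(1)
    unfolding edges_from_Suc[OF l] by auto
  have pg: "polyfun r g" and pq: "polyfun r q"
    using g(1) q(1) by (auto intro: represents_volume_polyfun)
  \<comment> \<open>Both stages, the inner targets and then the sink, preserve equations without
    \<open>\<partial>_l\<close>.\<close>
  have keep: "T g = (\<lambda>_. 0)" if "diff_operator l T" "T p = (\<lambda>_. 0)" for T
    using q(2) g(2) that by (simp add: extends_by_def)
  have "flow_operator r m l g = ?D id ((pderiv_at l ^^ m l (r + 1)) g)"
    unfolding flow_operator_def by (subst foldr_comp_append) simp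
  \<comment> \<open>Only \<open>m l (r + 1) - 1\<close> edges from \<open>l\<close> to the sink have
    been integrated, so undoing them leaves one \<open>pderiv_at l\<close> over.\<close>
  also have "(pderiv_at l ^^ m l (r + 1)) g = pderiv_at l ((pderiv_at l ^^ (m l (r + 1) - 1)) g)"
    using pos[OF l] by (cases "m l (r + 1)") auto
  also have "(pderiv_at l ^^ (m l (r + 1) - 1)) g = q"
    using g(2) unfolding extends_by_def funpow_pderiv_diff_outside(1)[OF pg] by simp
  \<comment> \<open>The surplus derivative moves past the inner operators, to act on
    \<open>p\<close>. The index 0 in \<open>diff_operator\<close> is a value that none of the
    operators involves, as all their indices are positive.\<close>
  also have "?D id (pderiv_at l q) = pderiv_at l (?D id q)"
    using l
    by (intro diff_operator_pderiv_at_commute[of 0, OF _ pq] diff_operator_foldr diff_operator.id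
        diff_operator_funpow diff_operator_pderiv_diff) auto
  also have "\<dots> = (\<lambda>_. 0)"
    using q(2) p(3)[of l] l by (simp add: extends_by_def)
  finally have "flow_operator r m l g = (\<lambda>_. 0)" .
  then have "\<forall>l'\<in>{l..r}. flow_operator r m l' g = (\<lambda>_. 0)"
  proof (intro ballI)
    fix l' assume l': "l' \<in> {l..r}"
    show "flow_operator r m l' g = (\<lambda>_. 0)"
    proof (cases "l' = l")
      case False
      then show ?thesis
        using l' by (intro keep[of "flow_operator r m l'"] p(2) diff_operator_flow_operator) auto
    qed (simp only: \<open>flow_operator r m l g = (\<lambda>_. 0)\<close>)
  qed
  moreover have "\<forall>i\<in>{1..<l}. pderiv_at i g = (\<lambda>_. 0)"
  proof
    fix i assume "i \<in> {1..<l}"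
    then show "pderiv_at i g = (\<lambda>_. 0)"
      by (intro keep[of "pderiv_at i"] p(3) diff_operator_pderiv_at) auto
  qed
  ultimately show ?case using g(1) by blast
qed

text \<open>Resolves the \<open>THE\<close> in \<open>nice_volume\<close>: two polynomial functions
  that agree on the closed orthant agree everywhere.\<close>

lemma nice_volume_eqI:
  assumes "homogeneous_polynomial r (flow_dim r m - r) p"
    and "\<And>a. (\<forall>i\<in>{1..r}. 0 \<le> a i) \<Longrightarrow> p a = flow_volume r m (chamber_vec r a)"
  shows "nice_volume r m = p"
  unfolding nice_volume_def
proof (rule the_equality)
  fix v
  assume v: "homogeneous_polynomial r (flow_dim r m - r) v \<and>
    (\<forall>a. (\<forall>i\<in>{1..r}. 0 \<le> a i) \<longrightarrow> v a = flow_volume r m (chamber_vec r a))"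
  have "v a - p a = 0" for a
  proof (rule polyfun_eq_zero_if_zero_on_orthant[of r "\<lambda>a. v a - p a"])
    show "polyfun r (\<lambda>a. v a - p a)"
      using polyfun_diff[OF polyfun_homogeneous[OF conjunct1[OF v]] polyfun_homogeneous[OF assms(1)]] .
    show "v a - p a = 0" if "\<forall>i\<in>{1..r}. 0 \<le> a i" for a
      using that v assms(2)[of a] by simp
  qed
  then show "v = p" by (auto simp: fun_eq_iff)
qed (use assms in blast)

theorem theorem3p1:
  fixes r :: nat and m :: "nat \<Rightarrow> nat \<Rightarrow> nat"
  assumes "1 \<le> r"
    and "\<And>i j. 1 \<le> i \<Longrightarrow> i < j \<Longrightarrow> j \<le> r + 1 \<Longrightarrow> 0 < m i j"
  shows "\<forall>l\<in>{1..r}. \<forall>a. flow_operator r m l (nice_volume r m) a = 0"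
proof -
  have pos: "0 < m i (r + 1)" if "i \<in> {1..r}" for i
    using assms(2)[of i "r + 1"] that by simp
  have "edges_from r m 1 = free_edges r m"
    by (auto simp: edges_from_def free_edges_def flow_index_def)
  with represents_volume_edges_from[of r m 1, OF pos] obtain p where
    p: "represents_volume r (free_edges r m) p"
      "\<And>l. l \<in> {1..r} \<Longrightarrow> flow_operator r m l p = (\<lambda>_. 0)" by auto
  have "nice_volume r m = p"
  proof (rule nice_volume_eqI)
    show "homogeneous_polynomial r (flow_dim r m - r) p"
      using p(1) card_free_edges[of r m, OF pos] by (simp add: represents_volume_def)
    show "p a = flow_volume r m (chamber_vec r a)" if "\<forall>i\<in>{1..r}. 0 \<le> a i" for a
      using p(1) that flow_volume_eq[of r m a, OF pos] by (simp add: represents_volume_def measure_def)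
  qed
  then show ?thesis using p(2) by simp
qed

end
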